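(* Let $1\le p<\infty$, $\alpha>-1$, let $u$ be an analytic function on the open unit disk $\mathbb{D}$ and $\varphi$ an analytic self-map of $\mathbb{D}$ such that the weighted composition operator $uC_\varphi:A^p_\alpha\to\mathcal{B}$ is bounded. Then $uC_\varphi:A^p_\alpha\to\mathcal{B}$ is compact if and only if $$\limsup_{j\to\infty}j^{(2+\alpha)/p}\|I_u(\varphi^j)\|_{\mathcal{B}}=0\quad\text{and}\quad\limsup_{j\to\infty}j^{(2+\alpha)/p}\|J_u(\varphi^{j-1})\|_{\mathcal{B}}=0,$$ where, for $g$ analytic on $\mathbb{D}$ and $z\in\mathbb{D}$, $$I_ug(z)=\int_0^zg'(\xi)u(\xi)\,d\xi,\qquad J_ug(z)=\int_0^zg(\xi)u'(\xi)\,d\xi.$$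
   Context: $H(\mathbb{D})$ is the space of analytic functions on the open unit disk $\mathbb{D}\subset\mathbb{C}$. For $u\in H(\mathbb{D})$ and an analytic $\varphi:\mathbb{D}\to\mathbb{D}$, the weighted composition operator is $(uC_\varphi f)(z)=u(z)f(\varphi(z))$, $f\in H(\mathbb{D})$. The weighted Bergman space $A^p_\alpha$ consists of all $f\in H(\mathbb{D})$ with $\|f\|_{A^p_\alpha}^p=(\alpha+1)\int_{\mathbb{D}}|f(z)|^p(1-|z|^2)^\alpha\,dA(z)<\infty$, where $dA$ is Lebesgue area measure normalized so that $A(\mathbb{D})=1$. The Bloch space $\mathcal{B}$ consists of all $f\in H(\mathbb{D})$ with $\sup_{z\in\mathbb{D}}(1-|z|^2)|f'(z)|<\infty$, with norm $\|f\|_{\mathcal{B}}=|f(0)|+\sup_{z\in\mathbb{D}}(1-|z|^2)|f'(z)|$. $\varphi^j$ denotes the $j$-th pointwise power of $\varphi$ (not an iterate), with $\varphi^0=1$. *)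

theory Defs
  imports "HOL-Complex_Analysis.Complex_Analysis"
begin

abbreviation unit_disk :: "complex set" where
  "unit_disk \<equiv> ball 0 1"

text \<open>Elements of \<open>H(\<D>)\<close> are represented by total functions that vanish off the disk, so that
  equality of analytic functions on the disk is equality in HOL.\<close>

definition hol_disk :: "(complex \<Rightarrow> complex) set" where
  "hol_disk = {f. f holomorphic_on unit_disk \<and> (\<forall>z. z \<notin> unit_disk \<longrightarrow> f z = 0)}"

definition weighted_comp ::
    "(complex \<Rightarrow> complex) \<Rightarrow> (complex \<Rightarrow> complex) \<Rightarrow> (complex \<Rightarrow> complex) \<Rightarrow> complex \<Rightarrow> complex" where
  "weighted_comp u \<phi> f = (\<lambda>z. if z \<in> unit_disk then u z * f (\<phi> z) else 0)"

definition disk_area :: "complex measure" where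
  "disk_area = uniform_measure lborel unit_disk"

definition bergman_integral :: "real \<Rightarrow> real \<Rightarrow> (complex \<Rightarrow> complex) \<Rightarrow> ennreal" where
  "bergman_integral p \<alpha> f =
     ennreal (\<alpha> + 1) *
       (\<integral>\<^sup>+z\<in>unit_disk. ennreal (cmod (f z) powr p * (1 - (cmod z)\<^sup>2) powr \<alpha>) \<partial>disk_area)"

definition bergman :: "real \<Rightarrow> real \<Rightarrow> (complex \<Rightarrow> complex) set" where
  "bergman p \<alpha> = {f \<in> hol_disk. bergman_integral p \<alpha> f < \<infinity>}"

definition bergman_norm :: "real \<Rightarrow> real \<Rightarrow> (complex \<Rightarrow> complex) \<Rightarrow> real" where
  "bergman_norm p \<alpha> f = enn2real (bergman_integral p \<alpha> f) powr (1 / p)"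

text \<open>The Bloch norm as an extended real, infinite exactly when the function is not Bloch.
  It only depends on the values on the disk.\<close>

definition bloch_enorm :: "(complex \<Rightarrow> complex) \<Rightarrow> ennreal" where
  "bloch_enorm f =
     ennreal (cmod (f 0)) + (SUP z\<in>unit_disk. ennreal ((1 - (cmod z)\<^sup>2) * cmod (deriv f z)))"

definition bloch :: "(complex \<Rightarrow> complex) set" where
  "bloch = {f \<in> hol_disk. bloch_enorm f < \<infinity>}"

definition bloch_norm :: "(complex \<Rightarrow> complex) \<Rightarrow> real" where
  "bloch_norm f = enn2real (bloch_enorm f)"

definition bloch_dist :: "(complex \<Rightarrow> complex) \<Rightarrow> (complex \<Rightarrow> complex) \<Rightarrow> real" where
  "bloch_dist f g = bloch_norm (\<lambda>z. f z - g z)"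

definition bounded_bergman_bloch ::
    "real \<Rightarrow> real \<Rightarrow> ((complex \<Rightarrow> complex) \<Rightarrow> complex \<Rightarrow> complex) \<Rightarrow> bool" where
  "bounded_bergman_bloch p \<alpha> T \<longleftrightarrow>
     T ` bergman p \<alpha> \<subseteq> bloch \<and>
     (\<exists>C. \<forall>f\<in>bergman p \<alpha>. bloch_norm (T f) \<le> C * bergman_norm p \<alpha> f)"

text \<open>Compactness: norm-bounded sets are mapped to relatively compact sets. That
  \<^term>\<open>bloch_dist\<close> is a metric on \<^term>\<open>bloch\<close> is lemma \<open>Metric_space_bloch\<close> below.\<close>

definition compact_bergman_bloch ::
    "real \<Rightarrow> real \<Rightarrow> ((complex \<Rightarrow> complex) \<Rightarrow> complex \<Rightarrow> complex) \<Rightarrow> bool" where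
  "compact_bergman_bloch p \<alpha> T \<longleftrightarrow>
     T ` bergman p \<alpha> \<subseteq> bloch \<and>
     (\<forall>S \<subseteq> bergman p \<alpha>. (\<exists>C. \<forall>f\<in>S. bergman_norm p \<alpha> f \<le> C) \<longrightarrow>
        compactin (Metric_space.mtopology bloch bloch_dist)
          (Metric_space.mtopology bloch bloch_dist closure_of (T ` S)))"

text \<open>The integrals from \<open>0\<close> to \<open>z\<close> are taken along the segment; the integrands are analytic, so
  the path is immaterial.\<close>

definition I_op :: "(complex \<Rightarrow> complex) \<Rightarrow> (complex \<Rightarrow> complex) \<Rightarrow> complex \<Rightarrow> complex" where
  "I_op u g = (\<lambda>z. if z \<in> unit_disk
     then contour_integral (linepath 0 z) (\<lambda>\<xi>. deriv g \<xi> * u \<xi>) else 0)"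

definition J_op :: "(complex \<Rightarrow> complex) \<Rightarrow> (complex \<Rightarrow> complex) \<Rightarrow> complex \<Rightarrow> complex" where
  "J_op u g = (\<lambda>z. if z \<in> unit_disk
     then contour_integral (linepath 0 z) (\<lambda>\<xi>. g \<xi> * deriv u \<xi>) else 0)"

lemma hol_disk_diff:
  assumes "f \<in> hol_disk" "g \<in> hol_disk"
  shows "(\<lambda>z. f z - g z) \<in> hol_disk"
  using assms by (auto simp: hol_disk_def intro!: holomorphic_intros)

lemma hol_disk_differentiable:
  assumes "f \<in> hol_disk" "z \<in> unit_disk"
  shows "f field_differentiable at z"
  using assms holomorphic_on_imp_differentiable_at[of f unit_disk z]
  by (simp add: hol_disk_def)

lemma bloch_enorm_minus_commute:
  "bloch_enorm (\<lambda>z. f z - g z) = bloch_enorm (\<lambda>z. g z - f z)"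
proof -
  have "cmod (deriv (\<lambda>z. f z - g z) z) = cmod (deriv (\<lambda>z. g z - f z) z)" for z
  proof -
    have minus: "((\<lambda>z. b z - a z) has_field_derivative - D) (at z)"
      if "((\<lambda>z. a z - b z) has_field_derivative D) (at z)" for a b :: "complex \<Rightarrow> complex" and D
      using DERIV_minus[OF that] by simp
    show ?thesis
    proof (cases "\<exists>D. ((\<lambda>z. f z - g z) has_field_derivative D) (at z)")
      case True
      then obtain D where D: "((\<lambda>z. f z - g z) has_field_derivative D) (at z)"
        by blast
      show ?thesis
        using DERIV_imp_deriv[OF D] DERIV_imp_deriv[OF minus[OF D]] by simp
    next
      case False
      then have "\<nexists>D. ((\<lambda>z. g z - f z) has_field_derivative D) (at z)"
        using minus by blast
      with False show ?thesis
        by (simp add: deriv_def)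
    qed
  qed
  then show ?thesis
    unfolding bloch_enorm_def by (simp add: norm_minus_commute)
qed

lemma bloch_enorm_triangle:
  assumes "f \<in> hol_disk" "g \<in> hol_disk"
  shows "bloch_enorm (\<lambda>z. f z - g z) \<le> bloch_enorm f + bloch_enorm g"
proof -
  define w where "w f z = ennreal ((1 - (cmod z)\<^sup>2) * cmod (deriv f z))" for f z
  have "w (\<lambda>z. f z - g z) z \<le> (SUP z\<in>unit_disk. w f z) + (SUP z\<in>unit_disk. w g z)"
    if z: "z \<in> unit_disk" for z
  proof -
    have le: "0 \<le> 1 - (cmod z)\<^sup>2"
      using z by (simp add: power_le_one)
    have "deriv (\<lambda>z. f z - g z) z = deriv f z - deriv g z"
      using hol_disk_differentiable[OF assms(1) z] hol_disk_differentiable[OF assms(2) z] by simp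
    then have "(1 - (cmod z)\<^sup>2) * cmod (deriv (\<lambda>z. f z - g z) z)
        \<le> (1 - (cmod z)\<^sup>2) * (cmod (deriv f z) + cmod (deriv g z))"
      using le by (intro mult_left_mono) (auto simp: norm_triangle_ineq4)
    then have "w (\<lambda>z. f z - g z) z \<le> w f z + w g z"
      unfolding w_def using le by (simp add: ennreal_plus[symmetric] distrib_left del: ennreal_plus)
    also have "\<dots> \<le> (SUP z\<in>unit_disk. w f z) + (SUP z\<in>unit_disk. w g z)"
      using z by (intro add_mono SUP_upper)
    finally show ?thesis .
  qed
  then have "(SUP z\<in>unit_disk. w (\<lambda>z. f z - g z) z)
      \<le> (SUP z\<in>unit_disk. w f z) + (SUP z\<in>unit_disk. w g z)"
    by (rule SUP_least)
  moreover have "ennreal (cmod (f 0 - g 0)) \<le> ennreal (cmod (f 0)) + ennreal (cmod (g 0))"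
    by (simp add: ennreal_plus[symmetric] norm_triangle_ineq4 del: ennreal_plus)
  ultimately have "ennreal (cmod (f 0 - g 0)) + (SUP z\<in>unit_disk. w (\<lambda>z. f z - g z) z)
      \<le> (ennreal (cmod (f 0)) + ennreal (cmod (g 0))) +
        ((SUP z\<in>unit_disk. w f z) + (SUP z\<in>unit_disk. w g z))"
    by (rule add_mono[rotated])
  then show ?thesis
    unfolding bloch_enorm_def w_def by (simp add: ac_simps)
qed

lemma bloch_diff:
  assumes "f \<in> bloch" "g \<in> bloch"
  shows "(\<lambda>z. f z - g z) \<in> bloch"
  using assms bloch_enorm_triangle[of f g] hol_disk_diff[of f g]
  by (auto simp: bloch_def ennreal_add_less_top intro: le_less_trans)

lemma bloch_enorm_eq_0:
  assumes f: "f \<in> hol_disk" and "bloch_enorm f = 0"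
  shows "f = (\<lambda>z. 0)"
proof
  fix z
  have f0: "f 0 = 0" and
    sup: "(SUP z\<in>unit_disk. ennreal ((1 - (cmod z)\<^sup>2) * cmod (deriv f z))) = 0"
    using assms(2) by (auto simp: bloch_enorm_def)
  have "deriv f z = 0" if z: "z \<in> unit_disk" for z
  proof -
    have "ennreal ((1 - (cmod z)\<^sup>2) * cmod (deriv f z)) \<le> 0"
      using SUP_upper[OF z, of "\<lambda>z. ennreal ((1 - (cmod z)\<^sup>2) * cmod (deriv f z))"] sup by simp
    moreover have "0 < 1 - (cmod z)\<^sup>2"
      using z by (simp add: power_less_one_iff)
    ultimately show ?thesis
      by (simp add: ennreal_eq_0_iff mult_le_0_iff)
  qed
  then have d: "(f has_field_derivative 0) (at z within unit_disk)" if "z \<in> unit_disk" for z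
    using hol_disk_differentiable[OF f that] that
    by (metis DERIV_deriv_iff_field_differentiable has_field_derivative_at_within)
  show "f z = 0"
  proof (cases "z \<in> unit_disk")
    case True
    from has_field_derivative_zero_constant[OF convex_ball d]
    obtain c where "\<And>x. x \<in> unit_disk \<Longrightarrow> f x = c"
      by blast
    then show ?thesis
      using True f0 by (metis centre_in_ball zero_less_one)
  next
    case False
    then show ?thesis
      using f by (simp add: hol_disk_def)
  qed
qed

lemma Metric_space_bloch: "Metric_space bloch bloch_dist"
proof
  fix f g :: "complex \<Rightarrow> complex"
  show "0 \<le> bloch_dist f g"
    by (simp add: bloch_dist_def bloch_norm_def)
next
  fix f g h
  assume fg: "f \<in> bloch" "g \<in> bloch"
  then have hol: "f \<in> hol_disk" "g \<in> hol_disk"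
    by (auto simp: bloch_def)
  show "(bloch_dist f g = 0) = (f = g)"
  proof
    assume "bloch_dist f g = 0"
    then have "bloch_enorm (\<lambda>z. f z - g z) = 0"
      using bloch_diff[OF fg] by (auto simp: bloch_dist_def bloch_norm_def bloch_def enn2real_eq_0_iff)
    from bloch_enorm_eq_0[OF hol_disk_diff[OF hol] this] show "f = g"
      by (simp add: fun_eq_iff)
  qed (simp add: bloch_dist_def bloch_norm_def bloch_enorm_def)
  assume h: "h \<in> bloch"
  have "bloch_enorm (\<lambda>z. f z - h z) \<le> bloch_enorm (\<lambda>z. f z - g z) + bloch_enorm (\<lambda>z. h z - g z)"
    using bloch_enorm_triangle[of "\<lambda>z. f z - g z" "\<lambda>z. h z - g z"]
      bloch_diff[OF fg] bloch_diff[OF h fg(2)] by (simp add: bloch_def)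
  also have "bloch_enorm (\<lambda>z. h z - g z) = bloch_enorm (\<lambda>z. g z - h z)"
    by (rule bloch_enorm_minus_commute)
  finally have "enn2real (bloch_enorm (\<lambda>z. f z - h z)) \<le>
      enn2real (bloch_enorm (\<lambda>z. f z - g z) + bloch_enorm (\<lambda>z. g z - h z))"
    using bloch_diff[OF fg] bloch_diff[OF fg(2) h]
    by (intro enn2real_mono) (auto simp: bloch_def ennreal_add_less_top)
  then show "bloch_dist f h \<le> bloch_dist f g + bloch_dist g h"
    using bloch_diff[OF fg] bloch_diff[OF fg(2) h]
    by (simp add: bloch_dist_def bloch_norm_def enn2real_plus bloch_def)
next
  fix f g
  show "bloch_dist f g = bloch_dist g f"
    unfolding bloch_dist_def bloch_norm_def by (rule arg_cong[OF bloch_enorm_minus_commute])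
qed

end

theory Submission
  imports Defs
begin

text \<open>Write \<open>s = (2 + \<alpha>) / p\<close>. Both sides are equivalent to the pointwise vanishing conditions
  \<open>(1 - |z|\<^sup>2) |u'(z)| = o((1 - |\<phi>(z)|\<^sup>2)\<^sup>s)\<close> and
  \<open>(1 - |z|\<^sup>2) |u(z) \<phi>'(z)| = o((1 - |\<phi>(z)|\<^sup>2)\<^bsup>s+1\<^esup>)\<close> as \<open>|\<phi>(z)| \<longrightarrow> 1\<close>.
  For the limsup conditions this is one-variable calculus: \<open>j\<^sup>s x\<^bsup>j-1\<^esup>\<close> is at most a constant times
  \<open>(1 - x\<^sup>2)\<^bsup>-s\<^esup>\<close> and is comparable to it when \<open>j\<close> is about \<open>1 / (1 - x)\<close>.
  The vanishing conditions give compactness by Montel's theorem and the growth estimates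
  \<open>|f(w)| = O((1 - |w|\<^sup>2)\<^bsup>-s\<^esup>)\<close>, \<open>|f'(w)| = O((1 - |w|\<^sup>2)\<^bsup>-s-1\<^esup>)\<close> on the unit ball of the
  Bergman space. Conversely, a compact operator sends a bounded family tending to zero pointwise
  together with its derivatives to a family with a null subsequence; normalised kernels
  \<open>(1 - |a|\<^sup>2)\<^bsup>N-s\<^esup> / (1 - cnj a z)\<^sup>N\<close> with \<open>a = \<phi>(z)\<close> make the growth estimates sharp and
  isolate each of the two conditions.\<close>

subsection \<open>Conformal change of variables\<close>

text \<open>The product rule splits the derivative of \<open>weighted_comp u \<phi> f\<close> into
  \<open>u' * f(\<phi>)\<close> and \<open>u * \<phi>' * f'(\<phi>)\<close>, and the two limsup
  conditions see these terms separately: functions produced by \<open>I_op\<close> and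
  \<open>J_op\<close> vanish at 0, so only their derivatives count, and differentiating
  \<open>\<phi>^j\<close> yields the factor \<open>j\<close> that lifts the exponent
  \<open>s\<close> to \<open>s + 1\<close>. The obstacle is that the two terms may cancel in the
  Bloch norm of a single image. Hence the test functions combine kernels of two consecutive orders,
  with coefficients that kill either the value or the derivative at the critical point. The exponent
  \<open>s\<close> comes from a disk about \<open>w\<close> whose radius is half the distance to the
  unit circle: its area gives 2, the weight on it gives \<alpha>, and a p-th root is taken.
  Boundedness of the operator enters through the images of 1 and \<open>z\<close>, which bound both
  weights where \<open>\<phi>\<close> stays away from the circle. Holomorphic changes of variables
  are needed twice: rotations for the mean value inequality, Moebius maps for the norms of the
  kernels.\<close>

text \<open>Change of variables with a Jacobian determinant is a theorem about
  \<open>real^'n\<close>; this transfer makes it available in the complex plane. Lebesgue measure is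
  determined by its values on boxes, and \<open>v\<close> carries the corners of a complex box to
  those of its preimage.\<close>

lemma lborel_complex_eq:
  "(lborel :: complex measure) = distr (lborel :: (real^2) measure) borel (\<lambda>x. Complex (x$1) (x$2))"
    (is "_ = distr _ _ ?V")
proof (rule lborel_eqI)
  have [measurable]: "?V \<in> borel_measurable borel"
    unfolding Complex_eq by measurable
  fix l u :: complex
  assume le: "\<And>b. b \<in> Basis \<Longrightarrow> l \<bullet> b \<le> u \<bullet> b"
  define v where "v z = (\<chi> i::2. if i = 1 then Re z else Im z)" for z
  have B: "Basis = {axis 1 1, axis 2 (1::real) :: real^2}"
    by (auto simp: Basis_vec_def UNIV_2)
  have ne: "axis 1 1 \<noteq> (axis 2 (1::real) :: real^2)"
    by (simp add: axis_eq_axis)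
  have eq: "?V -` box l u = box (v l) (v u)"
    by (auto simp: box_def B Basis_complex_def v_def inner_axis forall_2)
  have "emeasure (distr lborel borel ?V) (box l u) = emeasure lborel (box (v l) (v u))"
    by (subst emeasure_distr) (auto simp: eq)
  also have "\<dots> = (\<Prod>b\<in>Basis. (v u - v l) \<bullet> b)"
    using le[of 1] le[of \<i>] by (intro emeasure_lborel_box) (auto simp: B v_def inner_axis Basis_complex_def)
  also have "\<dots> = (\<Prod>b\<in>Basis. (u - l) \<bullet> b)"
    using ne by (simp add: B v_def inner_axis Basis_complex_def)
  finally show "emeasure (distr lborel borel ?V) (box l u) = (\<Prod>b\<in>Basis. (u - l) \<bullet> b)" .
qed simp

text \<open>A bridge between the measure-theoretic integral and the pair of
  \<open>absolutely_integrable_on\<close> and \<open>integral\<close> in which change of variables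
  is phrased. The infinite case is included so that no integrability has to be checked
  beforehand.\<close>

lemma nn_integral_lborel_eq_integral:
  fixes f :: "'a::euclidean_space \<Rightarrow> real"
  assumes [measurable]: "f \<in> borel_measurable borel" "S \<in> sets borel" and "\<And>x. 0 \<le> f x"
  shows "(\<integral>\<^sup>+x\<in>S. ennreal (f x) \<partial>lborel) =
    (if f absolutely_integrable_on S then ennreal (integral S f) else \<infinity>)"
proof -
  have eq: "(\<integral>\<^sup>+x\<in>S. ennreal (f x) \<partial>lborel) = (\<integral>\<^sup>+x. ennreal (indicator S x * f x) \<partial>lborel)"
    by (intro nn_integral_cong) (auto simp: indicator_def)
  have abs: "f absolutely_integrable_on S \<longleftrightarrow> integrable lborel (\<lambda>x. indicator S x * f x)"
    unfolding set_integrable_def by (simp add: integrable_completion)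
  show ?thesis
  proof (cases "integrable lborel (\<lambda>x. indicator S x * f x)")
    case True
    have "set_lebesgue_integral lebesgue S f = integral S f"
      using True abs by (intro set_lebesgue_integral_eq_integral(2)) auto
    then have "integral S f = (\<integral>x. indicator S x * f x \<partial>lborel)"
      unfolding set_lebesgue_integral_def by (simp add: integral_completion)
    then show ?thesis
      using True abs eq nn_integral_eq_integral[OF True] assms(3) by simp
  next
    case False
    then have "\<not> (\<integral>\<^sup>+x. ennreal (indicator S x * f x) \<partial>lborel) < \<infinity>"
      using assms(3) by (auto intro!: integrableI_nonneg)
    then have "(\<integral>\<^sup>+x. ennreal (indicator S x * f x) \<partial>lborel) = \<infinity>"
      by (metis infinity_ennreal_def top.not_eq_extremum)
    then show ?thesis
      using False abs eq by simp
  qed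
qed

lemma nn_integral_holomorphic_image:
  fixes g :: "complex \<Rightarrow> complex" and F :: "complex \<Rightarrow> real"
  assumes S: "open S" and g: "g holomorphic_on S" and inj: "inj_on g S"
    and F[measurable]: "F \<in> borel_measurable borel" and F0: "\<And>z. 0 \<le> F z"
  shows "(\<integral>\<^sup>+z\<in>g ` S. ennreal (F z) \<partial>lborel) =
    (\<integral>\<^sup>+z\<in>S. ennreal (F (g z) * (cmod (deriv g z))\<^sup>2) \<partial>lborel)"
proof -
  define V :: "real^2 \<Rightarrow> complex" where "V x = Complex (x$1) (x$2)" for x
  define W :: "complex \<Rightarrow> real^2" where "W z = (\<chi> i. if i = 1 then Re z else Im z)" for z
  have VW [simp]: "V (W z) = z" "W (V x) = x" for z x
    by (auto simp: V_def W_def vec_eq_iff forall_2)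
  have linV: "bounded_linear V"
    unfolding linear_conv_bounded_linear[symmetric]
    by (rule linearI) (auto simp: V_def complex_eq_iff)
  have linW: "bounded_linear W"
    unfolding linear_conv_bounded_linear[symmetric]
    by (rule linearI) (auto simp: W_def vec_eq_iff)
  have [measurable]: "V \<in> borel_measurable borel" "W \<in> borel_measurable borel"
    using linV linW by (auto intro!: borel_measurable_continuous_onI linear_continuous_on)
  have lb: "(\<integral>\<^sup>+z. h z \<partial>lborel) = (\<integral>\<^sup>+x. h (V x) \<partial>lborel)" if [measurable]: "h \<in> borel_measurable borel" for h
    unfolding lborel_complex_eq using nn_integral_distr[of V lborel borel h]
    using \<open>V \<in> borel_measurable borel\<close> by (simp add: V_def[abs_def])
  define T where "T = W ` S"
  define G where "G = W \<circ> g \<circ> V"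
  have T: "T = V -` S" unfolding T_def by (auto simp: image_iff) (metis VW(2))
  have oT: "open T"
    unfolding T using linV by (intro open_vimage S linear_continuous_on) auto
  have oI: "open (g ` S)"
    using open_mapping_thm3[OF g S inj] .
  have [measurable]: "S \<in> sets borel" "T \<in> sets borel" "g ` S \<in> sets borel"
    using S oT oI by auto
  have GT: "G ` T = V -` (g ` S)"
    unfolding G_def T by (auto simp: image_iff) (metis VW vimageI)
  have [measurable]: "G ` T \<in> sets borel"
    unfolding GT using measurable_sets[of V borel borel "g ` S"] by simp
  define g' where "g' x = (\<lambda>h. W (deriv g (V x) * V h))" for x
  have der: "(G has_derivative g' x) (at x within T)" if "x \<in> T" for x
  proof -
    have "V x \<in> S" using that T by auto
    then have "(g has_derivative (\<lambda>h. deriv g (V x) * h)) (at (V x))"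
      using g S by (simp add: has_field_derivative_imp_has_derivative holomorphic_derivI)
    then have "(G has_derivative g' x) (at x)"
      unfolding G_def g'_def comp_assoc
      using diff_chain_at[OF diff_chain_at[OF bounded_linear_imp_has_derivative[OF linV] ] bounded_linear_imp_has_derivative[OF linW],of g]
      by (simp add: o_def)
    then show ?thesis by (rule has_derivative_at_withinI)
  qed
  have injG: "inj_on G T"
    using inj unfolding inj_on_def G_def T by (auto) (metis VW)
  \<comment> \<open>Multiplication by \<open>a + b i\<close> has determinant
    \<open>a^2 + b^2\<close>, so the Jacobian of a holomorphic map is the squared modulus of its
    derivative.\<close>
  have det: "det (matrix (g' x)) = (cmod (deriv g (V x)))\<^sup>2" for x
    unfolding cmod_power2
    by (simp add: det_2 matrix_def g'_def V_def W_def axis_def power2_eq_square)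
  have [measurable]: "g \<in> borel_measurable (restrict_space borel S)"
    using g by (intro borel_measurable_continuous_on_restrict holomorphic_on_imp_continuous_on)
  have [measurable]: "deriv g \<in> borel_measurable (restrict_space borel S)"
    using g S by (intro borel_measurable_continuous_on_restrict holomorphic_on_imp_continuous_on holomorphic_deriv)
  define H where "H z = (if z \<in> S then F (g z) * (cmod (deriv g z))\<^sup>2 else 0)" for z
  have H[measurable]: "H \<in> borel_measurable borel"
    unfolding H_def by (rule measurable_If_restrict_space_iff[THEN iffD2]) auto
  have H0: "0 \<le> H z" for z by (simp add: H_def F0)
  have "(\<integral>\<^sup>+z\<in>g ` S. ennreal (F z) \<partial>lborel) = (\<integral>\<^sup>+x\<in>G ` T. ennreal (F (V x)) \<partial>lborel)"
    by (subst lb) (auto simp: GT indicator_def intro!: nn_integral_cong)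
  also have "\<dots> = (if (\<lambda>x. F (V x)) absolutely_integrable_on G ` T then ennreal (integral (G ` T) (\<lambda>x. F (V x))) else \<infinity>)"
    by (rule nn_integral_lborel_eq_integral) (auto simp: F0)
  also have "\<dots> = (if (\<lambda>x. H (V x)) absolutely_integrable_on T then ennreal (integral T (\<lambda>x. H (V x))) else \<infinity>)"
  proof -
    have eq: "\<bar>det (matrix (g' x))\<bar> * F (V (G x)) = H (V x)" if "x \<in> T" for x
      using that by (simp add: det H_def T G_def)
    have "integral T (\<lambda>x. \<bar>det (matrix (g' x))\<bar> * F (V (G x))) = integral T (\<lambda>x. H (V x))"
      by (intro integral_cong eq)
    moreover have "(\<lambda>x. \<bar>det (matrix (g' x))\<bar> * F (V (G x))) absolutely_integrable_on T \<longleftrightarrow> (\<lambda>x. H (V x)) absolutely_integrable_on T"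
      by (intro set_integrable_cong eq refl)
    \<comment> \<open>The theorem applied here has vector-valued integrands, so real ones pass
      through \<open>real^1\<close>. Since \<open>b\<close> is arbitrary, integrability and value
      are transported together; instantiating \<open>b\<close> with each of the two integrals gives
      both directions.\<close>
    moreover have "(\<lambda>x. \<bar>det (matrix (g' x))\<bar> *\<^sub>R (vec (F (V (G x))) :: real^1)) absolutely_integrable_on T \<and>
        integral T (\<lambda>x. \<bar>det (matrix (g' x))\<bar> *\<^sub>R (vec (F (V (G x))) :: real^1)) = vec b
        \<longleftrightarrow> (\<lambda>x. vec (F (V x)) :: real^1) absolutely_integrable_on (G ` T) \<and>
        integral (G ` T) (\<lambda>x. vec (F (V x)) :: real^1) = vec b" for b
      by (rule has_absolute_integral_change_of_variables) (use der injG oT in auto)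
    ultimately have iff: "(\<lambda>x. H (V x)) absolutely_integrable_on T \<and> integral T (\<lambda>x. H (V x)) = b \<longleftrightarrow>
        (\<lambda>x. F (V x)) absolutely_integrable_on (G ` T) \<and> integral (G ` T) (\<lambda>x. F (V x)) = b" for b
      by (simp add: absolutely_integrable_on_1_iff integral_on_1_eq)
    show ?thesis
      using iff[of "integral (G ` T) (\<lambda>x. F (V x))"] iff[of "integral T (\<lambda>x. H (V x))"] by auto
  qed
  also have "\<dots> = (\<integral>\<^sup>+x\<in>T. ennreal (H (V x)) \<partial>lborel)"
    by (rule nn_integral_lborel_eq_integral[symmetric]) (auto simp: H0)
  also have "\<dots> = (\<integral>\<^sup>+z\<in>S. ennreal (H z) \<partial>lborel)"
    by (subst lb) (auto simp: T indicator_def intro!: nn_integral_cong)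
  also have "\<dots> = (\<integral>\<^sup>+z\<in>S. ennreal (F (g z) * (cmod (deriv g z))\<^sup>2) \<partial>lborel)"
    by (auto simp: H_def indicator_def intro!: nn_integral_cong)
  finally show ?thesis .
qed


subsection \<open>Mean values over disks\<close>

lemma hol_disk_measurable:
  assumes "f \<in> hol_disk"
  shows "f \<in> borel_measurable borel"
proof -
  have "(\<lambda>z. indicator unit_disk z *\<^sub>R f z) \<in> borel_measurable borel"
    using assms by (intro borel_measurable_continuous_on_indicator)
      (auto simp: hol_disk_def holomorphic_on_imp_continuous_on)
  also have "(\<lambda>z. indicator unit_disk z *\<^sub>R f z) = f"
    using assms by (auto simp: hol_disk_def indicator_def fun_eq_iff)
  finally show ?thesis .
qed

text \<open>Cauchy's formula on the circle about \<open>w\<close> through \<open>z\<close>. Having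
  it for every \<open>z\<close> of the ball allows integration in \<open>z\<close>, which replaces
  polar coordinates in the area version.\<close>

lemma circle_mean_value:
  assumes [measurable]: "f \<in> borel_measurable borel"
    and hol: "f holomorphic_on ball w R" and z: "z \<in> ball w R"
  shows "ennreal (cmod (f w)) \<le>
    (\<integral>\<^sup>+t\<in>{0..1}. ennreal (cmod (f (w + exp (2 * of_real pi * \<i> * of_real t) * (z - w)))) \<partial>lborel)"
proof -
  define h where "h \<zeta> = f (w + \<zeta> * (z - w))" for \<zeta>
  define c where "c = circlepath 0 1"
  have c: "c t = exp (2 * of_real pi * \<i> * of_real t)" for t
    by (simp add: c_def circlepath)
  have nz: "cmod (z - w) < R" using z by (simp add: dist_norm norm_minus_commute)
  have "h holomorphic_on cball 0 1"
    unfolding h_def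
  proof (rule holomorphic_on_compose_gen[of "\<lambda>\<zeta>. w + \<zeta> * (z - w)" _ f "ball w R", unfolded o_def])
    show "(\<lambda>\<zeta>. w + \<zeta> * (z - w)) ` cball 0 1 \<subseteq> ball w R"
    proof clarsimp
      fix x :: complex assume "cmod x \<le> 1"
      then have "cmod x * cmod (z - w) \<le> 1 * cmod (z - w)" by (intro mult_right_mono) auto
      then show "dist w (w + x * (z - w)) < R"
        using nz by (simp add: dist_norm norm_mult)
    qed
  qed (auto intro!: holomorphic_intros hol)
  then have cont: "continuous_on {0..1} (\<lambda>t. h (c t))" and
    ci: "((\<lambda>u. h u / (u - 0)) has_contour_integral (2 * of_real pi * \<i> * h 0)) c"
    unfolding c_def
  proof -
    assume *: "h holomorphic_on cball 0 1"
    show "continuous_on {0..1} (\<lambda>t. h (circlepath 0 1 t))"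
      by (rule continuous_on_compose2[OF holomorphic_on_imp_continuous_on[OF *]])
        (auto simp: circlepath norm_mult intro!: continuous_intros)
    show "((\<lambda>u. h u / (u - 0)) has_contour_integral (2 * of_real pi * \<i> * h 0)) (circlepath 0 1)"
      by (rule Cauchy_integral_circlepath_simple[OF *]) auto
  qed
  have "((\<lambda>t. h (c t) / (c t - 0) * vector_derivative c (at t within {0..1})) has_integral
      2 * of_real pi * \<i> * h 0) {0..1}"
    using ci by (simp add: has_contour_integral_def)
  \<comment> \<open>The derivative of the path is \<open>2 pi i\<close> times the point on the unit
    circle, which cancels the denominator of the Cauchy kernel.\<close>
  then have "((\<lambda>t. 2 * of_real pi * \<i> * h (c t)) has_integral 2 * of_real pi * \<i> * h 0) {0..1}"
    by (rule has_integral_eq[rotated])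
      (use vector_derivative_circlepath01[of _ 0 1, folded c_def] in \<open>simp add: c\<close>)
  then have hi: "((\<lambda>t. h (c t)) has_integral h 0) {0..1}"
    using has_integral_mult_right[of "\<lambda>t. 2 * of_real pi * \<i> * h (c t)" "2 * of_real pi * \<i> * h 0" "{0..1}" "1 / (2 * of_real pi * \<i>)"]
    by simp
  have int: "(\<lambda>t. cmod (h (c t))) absolutely_integrable_on {0..1}"
    by (intro absolutely_integrable_continuous_real continuous_intros cont)
  have "cmod (h 0) \<le> integral {0..1} (\<lambda>t. cmod (h (c t)))"
    using hi integral_norm_bound_integral[of "\<lambda>t. h (c t)" "{0..1}" "\<lambda>t. cmod (h (c t))"] int
    by (auto simp: has_integral_iff set_lebesgue_integral_eq_integral)
  then have "ennreal (cmod (h 0)) \<le> (\<integral>\<^sup>+t\<in>{0..1}. ennreal (cmod (h (c t))) \<partial>lborel)"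
    using int by (subst nn_integral_lborel_eq_integral) (auto simp: h_def c intro!: ennreal_leI)
  then show ?thesis by (simp add: h_def c)
qed

lemma emeasure_ball_complex: "r \<ge> 0 \<Longrightarrow> emeasure lborel (ball (w::complex) r) = ennreal (pi * r\<^sup>2)"
  by (simp add: emeasure_ball unit_ball_vol_2)

text \<open>Integrate the circle inequality over the ball and exchange the integrals: for fixed
  \<open>t\<close> the inner integral is taken along a rotation about \<open>w\<close>, which
  preserves the ball and its area, so it does not depend on \<open>t\<close>.\<close>

lemma area_mean_value:
  assumes [measurable]: "f \<in> borel_measurable borel" and hol: "f holomorphic_on ball w r"
  shows "ennreal (cmod (f w)) * emeasure lborel (ball w r) \<le> (\<integral>\<^sup>+z\<in>ball w r. ennreal (cmod (f z)) \<partial>lborel)"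
proof -
  define e where "e t = exp (2 * of_real pi * \<i> * of_real t)" for t :: real
  define g where "g t z = w + e t * (z - w)" for t z
  have [measurable]: "ball w r \<in> sets borel" by simp
  have [measurable]: "e \<in> borel_measurable borel"
    unfolding e_def by (intro borel_measurable_continuous_onI continuous_intros)
  have e: "cmod (e t) = 1" for t by (simp add: e_def)
  have e0: "e t \<noteq> 0" for t by (simp add: e_def)
  have rot: "(\<integral>\<^sup>+z\<in>ball w r. ennreal (cmod (f (g t z))) \<partial>lborel) = (\<integral>\<^sup>+z\<in>ball w r. ennreal (cmod (f z)) \<partial>lborel)" for t
  proof -
    have inj: "inj_on (g t) (ball w r)"
      using e0 by (auto simp: inj_on_def g_def)
    have im: "g t ` ball w r = ball w r"
    proof (intro equalityI subsetI)
      fix z assume "z \<in> ball w r"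
      then have "g t (w + (z - w) / e t) = z" "w + (z - w) / e t \<in> ball w r"
        using e0 by (auto simp: g_def dist_norm norm_divide e norm_minus_commute)
      then show "z \<in> g t ` ball w r" by (metis image_eqI)
    qed (auto simp: g_def dist_norm norm_mult e norm_minus_commute)
    have der: "deriv (g t) z = e t" for z
      unfolding g_def by (rule DERIV_imp_deriv) (auto intro!: derivative_eq_intros)
    have "g t holomorphic_on ball w r"
      unfolding g_def by (intro holomorphic_intros)
    from nn_integral_holomorphic_image[OF open_ball this inj, of "\<lambda>z. cmod (f z)"]
    show ?thesis by (simp add: im der e)
  qed
  have "ennreal (cmod (f w)) * emeasure lborel (ball w r) = (\<integral>\<^sup>+z\<in>ball w r. ennreal (cmod (f w)) \<partial>lborel)"
    by (simp add: nn_integral_cmult_indicator)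
  also have "\<dots> \<le> (\<integral>\<^sup>+z\<in>ball w r. (\<integral>\<^sup>+t\<in>{0..1}. ennreal (cmod (f (g t z))) \<partial>lborel) \<partial>lborel)"
    using circle_mean_value[OF assms(1) hol]
    by (intro nn_integral_mono) (auto simp: indicator_def g_def e_def)
  also have "\<dots> = (\<integral>\<^sup>+z. (\<integral>\<^sup>+t. ennreal (cmod (f (g t z))) * indicator {0..1} t * indicator (ball w r) z \<partial>lborel) \<partial>lborel)"
    by (intro nn_integral_cong nn_integral_multc[symmetric]) (simp add: g_def)
  also have "\<dots> = (\<integral>\<^sup>+t. (\<integral>\<^sup>+z. ennreal (cmod (f (g t z))) * indicator {0..1} t * indicator (ball w r) z \<partial>lborel) \<partial>lborel)"
    by (rule lborel_pair.Fubini') (unfold g_def split_beta, measurable)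
  also have "\<dots> = (\<integral>\<^sup>+t. indicator {0..1} t * (\<integral>\<^sup>+z\<in>ball w r. ennreal (cmod (f (g t z))) \<partial>lborel) \<partial>lborel)"
    by (subst nn_integral_cmult[symmetric]) (auto simp: g_def mult_ac)
  also have "\<dots> = (\<integral>\<^sup>+z\<in>ball w r. ennreal (cmod (f z)) \<partial>lborel)"
    unfolding rot by (simp add: nn_integral_multc)
  finally show ?thesis .
qed

text \<open>The factor 1/2 pays for an elementary inequality in place of convexity: with
  \<open>l\<close> half of \<open>|f w|\<close>, the constant part of the bound absorbs half of the
  mean value, and the other half is left to the p-th powers.\<close>

lemma area_mean_value_powr:
  assumes f[measurable]: "f \<in> borel_measurable borel" and hol: "f holomorphic_on ball w r"
    and p: "1 \<le> p" and r: "0 \<le> r"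
  shows "ennreal ((cmod (f w) / 2) powr p * (pi * r\<^sup>2)) \<le> (\<integral>\<^sup>+z\<in>ball w r. ennreal (cmod (f z) powr p) \<partial>lborel)"
    (is "_ \<le> ?M")
proof (cases "f w = 0 \<or> ?M = \<infinity>")
  case False
  have [measurable]: "ball w r \<in> sets borel" by simp
  define l where "l = cmod (f w) / 2"
  have l: "l > 0" using False by (simp add: l_def)
  obtain m where m: "?M = ennreal m" "m \<ge> 0"
    using False by (cases ?M) auto
  \<comment> \<open>A substitute for Jensen's inequality: \<open>t \<le> l + l powr (1 - p) * t powr p\<close>.\<close>
  have le: "t \<le> l + l powr (1 - p) * t powr p" if "t \<ge> 0" for t
  proof (cases "t \<le> l")
    case False
    then have "t = t powr (1 - p) * t powr p"
      using l by (simp add: powr_add[symmetric])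
    also have "\<dots> \<le> l powr (1 - p) * t powr p"
      using False l p by (intro mult_right_mono powr_mono2') auto
    finally show ?thesis using l by linarith
  qed (simp add: add_increasing2)
  have "ennreal (cmod (f w) * (pi * r\<^sup>2)) = ennreal (cmod (f w)) * emeasure lborel (ball w r)"
    using r by (simp add: emeasure_ball_complex ennreal_mult)
  also have "\<dots> \<le> (\<integral>\<^sup>+z\<in>ball w r. ennreal (cmod (f z)) \<partial>lborel)"
    by (rule area_mean_value[OF f hol])
  also have "\<dots> \<le> (\<integral>\<^sup>+z. ennreal l * indicator (ball w r) z + ennreal (l powr (1 - p)) * (ennreal (cmod (f z) powr p) * indicator (ball w r) z) \<partial>lborel)"
  proof (intro nn_integral_mono)
    fix z
    show "ennreal (cmod (f z)) * indicator (ball w r) z \<le> ennreal l * indicator (ball w r) z + ennreal (l powr (1 - p)) * (ennreal (cmod (f z) powr p) * indicator (ball w r) z)"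
      using le[of "cmod (f z)"] l
      by (auto simp: indicator_def ennreal_mult[symmetric] ennreal_plus[symmetric] simp del: ennreal_plus intro!: ennreal_leI)
  qed
  also have "\<dots> = ennreal l * ennreal (pi * r\<^sup>2) + ennreal (l powr (1 - p)) * ?M"
    by (subst nn_integral_add, measurable, subst nn_integral_cmult, measurable)
      (use r in \<open>simp_all add: nn_integral_cmult_indicator emeasure_ball_complex\<close>)
  also have "\<dots> = ennreal (l * (pi * r\<^sup>2) + l powr (1 - p) * m)"
    using l m by (simp add: ennreal_mult[symmetric] ennreal_plus[symmetric] del: ennreal_plus)
  finally have "2 * l * (pi * r\<^sup>2) \<le> l * (pi * r\<^sup>2) + l powr (1 - p) * m"
    using l m by (subst (asm) ennreal_le_iff) (auto simp: l_def)
  then have "l * (pi * r\<^sup>2) \<le> l powr (1 - p) * m" by (simp add: algebra_simps)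
  then have "l powr (p - 1) * (l * (pi * r\<^sup>2)) \<le> l powr (p - 1) * (l powr (1 - p) * m)"
    by (intro mult_left_mono) auto
  also have "l powr (p - 1) * (l powr (1 - p) * m) = m"
    using l by (simp add: powr_add[symmetric] mult.assoc[symmetric])
  also have "l powr (p - 1) * (l * (pi * r\<^sup>2)) = l powr p * (pi * r\<^sup>2)"
    using l by (simp add: powr_diff field_simps)
  finally show ?thesis
    using m by (simp add: l_def ennreal_leI)
qed (use p in auto)


subsection \<open>Growth of Bergman functions\<close>

lemma bergman_integral_eq:
  assumes [measurable]: "f \<in> borel_measurable borel" and "-1 < \<alpha>"
  shows "bergman_integral p \<alpha> f = ennreal ((\<alpha> + 1) / pi) *
    (\<integral>\<^sup>+z\<in>unit_disk. ennreal (cmod (f z) powr p * (1 - (cmod z)\<^sup>2) powr \<alpha>) \<partial>lborel)" (is "_ = _ * ?I")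
proof -
  have [measurable]: "unit_disk \<in> sets borel" by simp
  have "(\<integral>\<^sup>+z\<in>unit_disk. ennreal (cmod (f z) powr p * (1 - (cmod z)\<^sup>2) powr \<alpha>) \<partial>disk_area) =
    (\<integral>\<^sup>+z. ennreal (cmod (f z) powr p * (1 - (cmod z)\<^sup>2) powr \<alpha>) * indicator unit_disk z * indicator unit_disk z \<partial>lborel)
      / emeasure lborel unit_disk"
    unfolding disk_area_def by (intro nn_integral_uniform_measure) auto
  also have "\<dots> = ?I / ennreal pi"
    by (intro arg_cong2[where f = "(/)"] nn_integral_cong) (auto simp: indicator_def emeasure_ball_complex)
  also have "\<dots> = ennreal (1 / pi) * ?I"
    by (simp add: divide_ennreal_def inverse_ennreal mult.commute inverse_eq_divide)
  finally show ?thesis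
    using assms(2) by (simp add: bergman_integral_def mult.assoc[symmetric] ennreal_mult[symmetric])
qed

lemma bergman_integral_eq_norm:
  assumes "f \<in> bergman p \<alpha>" "0 < p"
  shows "bergman_integral p \<alpha> f = ennreal (bergman_norm p \<alpha> f powr p)"
  using assms by (simp add: bergman_def bergman_norm_def powr_powr)

text \<open>The absolute value treats exponents of either sign at once. It is applied with \<alpha>,
  which may be negative, to ratios of comparable distances.\<close>

lemma powr_ratio_bound:
  fixes x a :: real
  assumes "1 / c \<le> x" "x \<le> c" "0 < c"
  shows "x powr a \<le> c powr \<bar>a\<bar>" "c powr - \<bar>a\<bar> \<le> x powr a"
proof -
  have c: "1 \<le> c"
  proof (rule ccontr)
    assume "\<not> 1 \<le> c"
    then have "1 < 1 / c" using assms(3) by simp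
    with assms \<open>\<not> 1 \<le> c\<close> show False by linarith
  qed
  have x: "x > 0" using assms by (smt (verit) divide_pos_pos)
  have ln: "ln x \<le> ln c" "- ln c \<le> ln x"
    using assms x c by (auto simp flip: ln_inverse ln_div simp: inverse_eq_divide)
  have "\<bar>a * ln x\<bar> \<le> \<bar>a\<bar> * ln c"
    using ln by (simp add: abs_mult mult_left_mono abs_le_iff)
  then have "a * ln x \<le> \<bar>a\<bar> * ln c" "- \<bar>a\<bar> * ln c \<le> a * ln x" by linarith+
  with x c show "x powr a \<le> c powr \<bar>a\<bar>" "c powr - \<bar>a\<bar> \<le> x powr a"
    by (auto simp: powr_def)
qed

lemma one_minus_cmod_sq:
  assumes "w \<in> unit_disk"
  shows "1 - cmod w \<le> 1 - (cmod w)\<^sup>2" "1 - (cmod w)\<^sup>2 \<le> 2 * (1 - cmod w)" "0 < 1 - (cmod w)\<^sup>2"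
proof -
  have *: "1 - (cmod w)\<^sup>2 = (1 - cmod w) * (1 + cmod w)" by (simp add: power2_eq_square algebra_simps)
  have "0 < 1 - cmod w" using assms by simp
  then show "1 - cmod w \<le> 1 - (cmod w)\<^sup>2" "1 - (cmod w)\<^sup>2 \<le> 2 * (1 - cmod w)" "0 < 1 - (cmod w)\<^sup>2"
    unfolding * using mult_left_mono[of 1 "1 + cmod w" "1 - cmod w"] mult_left_mono[of "1 + cmod w" 2 "1 - cmod w"]
    by (auto simp: mult.commute intro!: mult_pos_pos add_pos_nonneg)
qed

text \<open>On a disk of radius \<open>r\<close>, half the distance to the circle, the weight is
  comparable to \<open>r\<close>: \<open>1 - |z|\<close> lies between \<open>r\<close> and
  \<open>3 r\<close>, and passing to \<open>1 - |z|^2\<close> costs at most a factor 2.\<close>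

lemma half_disk:
  assumes "w \<in> unit_disk" and "cmod (z - w) \<le> (1 - cmod w) / 2"
  shows "z \<in> unit_disk" "(1 - cmod w) / 2 \<le> 1 - (cmod z)\<^sup>2" "1 - (cmod z)\<^sup>2 \<le> 6 * ((1 - cmod w) / 2)"
proof -
  have "cmod z \<le> cmod w + cmod (z - w)" "cmod w \<le> cmod z + cmod (z - w)"
    by norm+
  then have "(1 - cmod w) / 2 \<le> 1 - cmod z" "1 - cmod z \<le> 3 * ((1 - cmod w) / 2)"
    using assms(2) by (auto simp: field_simps)
  moreover from this show z: "z \<in> unit_disk" using assms(1) by auto
  moreover note one_minus_cmod_sq[OF z]
  ultimately show "(1 - cmod w) / 2 \<le> 1 - (cmod z)\<^sup>2" "1 - (cmod z)\<^sup>2 \<le> 6 * ((1 - cmod w) / 2)"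
    by auto
qed

text \<open>The mean value inequality for p-th powers on the half-distance disk, where the weight is
  about \<open>r powr \<alpha>\<close>. Dividing by the area \<open>pi * r^2\<close> and taking the
  p-th root produces the exponent.\<close>

lemma bergman_pointwise_bound:
  assumes p: "1 \<le> p" and \<alpha>: "-1 < \<alpha>"
  obtains K where "0 < K" and "\<And>f w. f \<in> bergman p \<alpha> \<Longrightarrow> w \<in> unit_disk \<Longrightarrow>
    cmod (f w) \<le> K * bergman_norm p \<alpha> f * (1 - (cmod w)\<^sup>2) powr (- ((2 + \<alpha>) / p))"
proof -
  \<comment> \<open>\<open>2 powr p\<close> comes from the halved mean value, the power of 6 from
    the comparison of weights, the division by \<open>\<alpha> + 1\<close> from the normalisation of
    the norm, and the power of 4 from \<open>r >= (1 - |w|^2) / 4\<close>.\<close>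
  define K where "K = 2 powr p * 6 powr \<bar>\<alpha>\<bar> / (\<alpha> + 1) * 4 powr (2 + \<alpha>)"
  have K: "K > 0" using \<alpha> by (simp add: K_def)
  have "cmod (f w) \<le> K powr (1 / p) * bergman_norm p \<alpha> f * (1 - (cmod w)\<^sup>2) powr (- ((2 + \<alpha>) / p))"
    if f: "f \<in> bergman p \<alpha>" and w: "w \<in> unit_disk" for f w
  proof -
    define N where "N = bergman_norm p \<alpha> f"
    have N: "N \<ge> 0" by (simp add: N_def bergman_norm_def)
    have fd: "f \<in> hol_disk" using f by (simp add: bergman_def)
    note [measurable] = hol_disk_measurable[OF fd]
    have [measurable]: "unit_disk \<in> sets borel" by simp
    define r where "r = (1 - cmod w) / 2"
    have r: "r > 0" using w by (simp add: r_def)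
    have sub: "z \<in> unit_disk" "r \<le> 1 - (cmod z)\<^sup>2" "1 - (cmod z)\<^sup>2 \<le> 6 * r" if "z \<in> ball w r" for z
      using half_disk[OF w, of z] that by (auto simp: r_def dist_norm norm_minus_commute)
    have "f holomorphic_on ball w r"
      using fd sub(1) by (auto simp: hol_disk_def intro: holomorphic_on_subset)
    from area_mean_value_powr[OF hol_disk_measurable[OF fd] this p] r
    have "ennreal ((cmod (f w) / 2) powr p * (pi * r\<^sup>2)) \<le> (\<integral>\<^sup>+z\<in>ball w r. ennreal (cmod (f z) powr p) \<partial>lborel)"
      by simp
    also have "\<dots> \<le> (\<integral>\<^sup>+z. ennreal (6 powr \<bar>\<alpha>\<bar> * r powr (- \<alpha>)) *
        (ennreal (cmod (f z) powr p * (1 - (cmod z)\<^sup>2) powr \<alpha>) * indicator unit_disk z) \<partial>lborel)"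
    proof (intro nn_integral_mono)
      fix z
      have "cmod (f z) powr p \<le> 6 powr \<bar>\<alpha>\<bar> * r powr (- \<alpha>) * (cmod (f z) powr p * (1 - (cmod z)\<^sup>2) powr \<alpha>)"
        if z: "z \<in> ball w r"
      proof -
        define y where "y = 1 - (cmod z)\<^sup>2"
        have y: "r \<le> y" "y \<le> 6 * r" using sub[OF z] by (auto simp: y_def)
        have "6 powr - \<bar>\<alpha>\<bar> \<le> (y / r) powr \<alpha>"
          using y r by (intro powr_ratio_bound) (auto simp: field_simps)
        then have "1 \<le> 6 powr \<bar>\<alpha>\<bar> * (r powr (- \<alpha>) * y powr \<alpha>)"
          using r y by (simp add: powr_divide powr_minus field_simps)
        then have "1 * cmod (f z) powr p \<le> 6 powr \<bar>\<alpha>\<bar> * (r powr (- \<alpha>) * y powr \<alpha>) * cmod (f z) powr p"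
          by (intro mult_right_mono) auto
        then show ?thesis by (simp add: y_def mult_ac)
      qed
      then show "ennreal (cmod (f z) powr p) * indicator (ball w r) z \<le> ennreal (6 powr \<bar>\<alpha>\<bar> * r powr (- \<alpha>)) *
        (ennreal (cmod (f z) powr p * (1 - (cmod z)\<^sup>2) powr \<alpha>) * indicator unit_disk z)"
        using sub(1)[of z] by (auto simp: indicator_def ennreal_mult[symmetric] intro!: ennreal_leI)
    qed
    also have "\<dots> = ennreal (6 powr \<bar>\<alpha>\<bar> * r powr (- \<alpha>)) *
        (\<integral>\<^sup>+z\<in>unit_disk. ennreal (cmod (f z) powr p * (1 - (cmod z)\<^sup>2) powr \<alpha>) \<partial>lborel)"
      by (rule nn_integral_cmult) measurable
    also have "(\<integral>\<^sup>+z\<in>unit_disk. ennreal (cmod (f z) powr p * (1 - (cmod z)\<^sup>2) powr \<alpha>) \<partial>lborel) =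
        ennreal (pi / (\<alpha> + 1)) * bergman_integral p \<alpha> f"
      using \<alpha> by (simp add: bergman_integral_eq mult.assoc[symmetric] ennreal_mult[symmetric])
    also have "bergman_integral p \<alpha> f = ennreal (N powr p)"
      using f p by (simp add: bergman_integral_eq_norm N_def)
    also have "ennreal (6 powr \<bar>\<alpha>\<bar> * r powr (- \<alpha>)) * (ennreal (pi / (\<alpha> + 1)) * ennreal (N powr p)) =
        ennreal (6 powr \<bar>\<alpha>\<bar> * r powr (- \<alpha>) * (pi / (\<alpha> + 1) * N powr p))"
      using \<alpha> by (simp add: ennreal_mult[symmetric])
    finally have "(cmod (f w) / 2) powr p * (pi * r\<^sup>2) \<le> 6 powr \<bar>\<alpha>\<bar> * r powr (- \<alpha>) * (pi / (\<alpha> + 1) * N powr p)"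
      using \<alpha> by (subst (asm) ennreal_le_iff) auto
    moreover have "r powr (- \<alpha>) = r powr (- (2 + \<alpha>)) * r\<^sup>2"
      using r powr_add[of r "- (2 + \<alpha>)" 2] by (simp add: powr_numeral)
    ultimately have "cmod (f w) powr p * (r\<^sup>2 * pi) \<le> 2 powr p * 6 powr \<bar>\<alpha>\<bar> / (\<alpha> + 1) * N powr p * r powr (- (2 + \<alpha>)) * (r\<^sup>2 * pi)"
      using \<alpha> by (simp add: powr_divide field_simps)
    then have le: "cmod (f w) powr p \<le> 2 powr p * 6 powr \<bar>\<alpha>\<bar> / (\<alpha> + 1) * N powr p * r powr (- (2 + \<alpha>))"
      using r by (subst (asm) mult_le_cancel_right) auto
    have "r powr (- (2 + \<alpha>)) \<le> ((1 - (cmod w)\<^sup>2) / 4) powr (- (2 + \<alpha>))"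
      using one_minus_cmod_sq[OF w] \<alpha> by (intro powr_mono2') (auto simp: r_def)
    also have "\<dots> = 4 powr (2 + \<alpha>) * (1 - (cmod w)\<^sup>2) powr (- (2 + \<alpha>))"
      using one_minus_cmod_sq[OF w] by (simp add: powr_divide divide_simps flip: powr_add)
    finally have "2 powr p * 6 powr \<bar>\<alpha>\<bar> / (\<alpha> + 1) * N powr p * r powr (- (2 + \<alpha>)) \<le>
        2 powr p * 6 powr \<bar>\<alpha>\<bar> / (\<alpha> + 1) * N powr p * (4 powr (2 + \<alpha>) * (1 - (cmod w)\<^sup>2) powr (- (2 + \<alpha>)))"
      using \<alpha> by (intro mult_left_mono) auto
    with le have le: "cmod (f w) powr p \<le> K * N powr p * (1 - (cmod w)\<^sup>2) powr (- (2 + \<alpha>))"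
      by (simp add: K_def mult_ac)
    have "cmod (f w) = (cmod (f w) powr p) powr (1 / p)"
      using p by (simp add: powr_powr)
    also have "\<dots> \<le> (K * N powr p * (1 - (cmod w)\<^sup>2) powr (- (2 + \<alpha>))) powr (1 / p)"
      using p by (intro powr_mono2 le) auto
    also have "\<dots> = K powr (1 / p) * N * (1 - (cmod w)\<^sup>2) powr (- ((2 + \<alpha>) / p))"
      using p K N by (simp add: powr_mult powr_powr minus_divide_left)
    finally show ?thesis by (simp add: N_def)
  qed
  then show thesis
    using K by (intro that[of "K powr (1 / p)"]) auto
qed

text \<open>Cauchy's estimate on the circle of half-distance radius. Both that radius and the weight
  along the circle are at least \<open>(1 - |w|^2) / 4\<close>, so dividing by the radius adds one
  to the exponent of the weight and of 4.\<close>

lemma deriv_pointwise_bound: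
  assumes hol: "f holomorphic_on unit_disk" and s: "0 \<le> s"
    and bd: "\<And>z. z \<in> unit_disk \<Longrightarrow> cmod (f z) \<le> B * (1 - (cmod z)\<^sup>2) powr (- s)"
    and w: "w \<in> unit_disk" and B: "0 \<le> B"
  shows "cmod (deriv f w) \<le> 4 powr (s + 1) * B * (1 - (cmod w)\<^sup>2) powr (- (s + 1))"
proof -
  define r where "r = (1 - cmod w) / 2"
  have r: "r > 0" using w by (simp add: r_def)
  define d where "d = 1 - (cmod w)\<^sup>2"
  have d: "d > 0" "d / 4 \<le> r" using one_minus_cmod_sq[OF w] by (auto simp: r_def d_def)
  have sub: "z \<in> unit_disk" "r \<le> 1 - (cmod z)\<^sup>2" if "cmod (z - w) \<le> r" for z
    using half_disk[OF w, of z] that by (auto simp: r_def)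
  have sub': "cball w r \<subseteq> unit_disk" using sub(1) by (auto simp: dist_norm norm_minus_commute)
  have "cmod ((deriv ^^ 1) f w) \<le> fact 1 * (B * (d / 4) powr (- s)) / r ^ 1"
  proof (rule Cauchy_inequality[OF _ _ r])
    show "f holomorphic_on ball w r"
      using hol sub' by (meson ball_subset_cball holomorphic_on_subset)
    show "continuous_on (cball w r) f"
      using hol sub' by (meson holomorphic_on_imp_continuous_on holomorphic_on_subset)
    fix z assume "cmod (w - z) = r"
    then have z: "z \<in> unit_disk" "r \<le> 1 - (cmod z)\<^sup>2" using sub[of z] by (auto simp: norm_minus_commute)
    have "cmod (f z) \<le> B * (1 - (cmod z)\<^sup>2) powr (- s)" by (rule bd[OF z(1)])
    also have "\<dots> \<le> B * (d / 4) powr (- s)"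
      using z d s B by (intro mult_left_mono powr_mono2') auto
    finally show "cmod (f z) \<le> B * (d / 4) powr (- s)" .
  qed
  also have "\<dots> \<le> (B * (d / 4) powr (- s)) / (d / 4)"
    using d r B by (simp only: fact_1 power_one_right mult_1) (intro divide_left_mono, auto)
  also have "\<dots> = 4 powr (s + 1) * B * d powr (- (s + 1))"
    using d by (simp add: powr_divide powr_minus powr_add powr_diff divide_simps)
  finally show ?thesis by (simp add: d_def)
qed


subsection \<open>Weighted kernel integrals\<close>

text \<open>A dyadic decomposition. The sets \<open>A k\<close>, where
  \<open>1 - |z|^2 <= 2^(-k)\<close>, are nested rather than disjoint, which makes their areas
  simple and does no harm in an upper bound. The weighted areas form a geometric series of ratio
  \<open>2 powr (-(1 + \<alpha>))\<close>, less than 1 as \<open>\<alpha> > -1\<close>.\<close>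

lemma nn_integral_disk_weight_finite:
  assumes \<alpha>: "-1 < \<alpha>"
  shows "(\<integral>\<^sup>+z\<in>unit_disk. ennreal ((1 - (cmod z)\<^sup>2) powr \<alpha>) \<partial>lborel) < \<infinity>"
proof -
  define A where "A k = unit_disk - ball (0::complex) (sqrt (1 - 2 powr (- real k)))" for k
  define c where "c k = 2 powr \<bar>\<alpha>\<bar> * 2 powr (- real k * \<alpha>)" for k
  have [measurable]: "A k \<in> sets borel" for k by (simp add: A_def)
  have le1: "2 powr (- real k) \<le> 1" for k
    using powr_mono[of "- real k" 0 2] by simp
  have A: "emeasure lborel (A k) = ennreal (pi * 2 powr (- real k))" for k
  proof -
    have "ball (0::complex) (sqrt (1 - 2 powr (- real k))) \<subseteq> unit_disk" by (intro subset_ball) simp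
    then have "emeasure lborel (A k) = emeasure lborel unit_disk - emeasure lborel (ball (0::complex) (sqrt (1 - 2 powr (- real k))))"
      unfolding A_def using le1[of k] by (intro emeasure_Diff) (auto simp: emeasure_ball_complex)
    also have "\<dots> = ennreal (pi * 2 powr (- real k))"
      using le1[of k] by (simp add: emeasure_ball_complex ennreal_minus algebra_simps)
    finally show ?thesis .
  qed
  have "ennreal ((1 - (cmod z)\<^sup>2) powr \<alpha>) * indicator unit_disk z \<le> (\<Sum>k. ennreal (c k) * indicator (A k) z)" for z :: complex
  proof (cases "z \<in> unit_disk")
    case True
    define h where "h = 1 - (cmod z)\<^sup>2"
    have h: "0 < h" "h \<le> 1" using one_minus_cmod_sq[OF True] by (auto simp: h_def)
    \<comment> \<open>The dyadic level of \<open>h\<close>: it makes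
      \<open>2^(-k) / 2 < h <= 2^(-k)\<close>, and the single term with this index dominates the
      integrand at \<open>z\<close>.\<close>
    define k where "k = nat \<lfloor>- log 2 h\<rfloor>"
    have "0 \<le> - log 2 h" using h by simp
    then have k: "real k \<le> - log 2 h" "- log 2 h < real k + 1" unfolding k_def by linarith+
    define t where "t = 2 powr (- real k)"
    have "2 powr (- real k - 1) < 2 powr (log 2 h)" "2 powr (log 2 h) \<le> t"
      unfolding t_def using k by (auto intro!: powr_less_mono powr_mono)
    then have t: "t / 2 < h" "h \<le> t" "0 < t" using h by (auto simp: powr_diff t_def)
    have "(h / t) powr \<alpha> \<le> 2 powr \<bar>\<alpha>\<bar>"
      using t by (intro powr_ratio_bound) (auto simp: field_simps)
    then have "h powr \<alpha> \<le> c k"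
      using t h by (simp add: c_def powr_divide field_simps) (simp add: t_def powr_powr mult_ac)
    moreover have "z \<in> A k"
    proof -
      have "sqrt (1 - t) \<le> sqrt ((cmod z)\<^sup>2)" using t by (intro real_sqrt_le_mono) (simp add: h_def)
      then show ?thesis using True by (simp add: A_def t_def)
    qed
    ultimately have "ennreal ((1 - (cmod z)\<^sup>2) powr \<alpha>) * indicator unit_disk z \<le> (\<Sum>k\<in>{k}. ennreal (c k) * indicator (A k) z)"
      using True by (simp add: h_def ennreal_leI)
    also have "\<dots> \<le> (\<Sum>k. ennreal (c k) * indicator (A k) z)"
      by (intro sum_le_suminf) auto
    finally show ?thesis .
  qed simp
  then have "(\<integral>\<^sup>+z\<in>unit_disk. ennreal ((1 - (cmod z)\<^sup>2) powr \<alpha>) \<partial>lborel) \<le> (\<integral>\<^sup>+z. (\<Sum>k. ennreal (c k) * indicator (A k) z) \<partial>lborel)"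
    by (intro nn_integral_mono) auto
  also have "\<dots> = (\<Sum>k. ennreal (c k) * emeasure lborel (A k))"
    by (subst nn_integral_suminf) (simp_all add: nn_integral_cmult_indicator)
  also have "\<dots> = (\<Sum>k. ennreal (c k * (pi * 2 powr (- real k))))"
    unfolding A by (simp add: c_def ennreal_mult)
  also have "\<dots> < \<infinity>"
  proof -
    have "2 powr (- (1 + \<alpha>)) < 1"
      using \<alpha> powr_less_mono[of "- (1 + \<alpha>)" 0 2] by simp
    then have "summable (\<lambda>k. 2 powr \<bar>\<alpha>\<bar> * pi * (2 powr (- (1 + \<alpha>))) ^ k)"
      by (intro summable_mult summable_geometric) simp
    also have "(\<lambda>k. 2 powr \<bar>\<alpha>\<bar> * pi * (2 powr (- (1 + \<alpha>))) ^ k) = (\<lambda>k. c k * (pi * 2 powr (- real k)))"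
      by (simp add: fun_eq_iff c_def powr_realpow[symmetric] powr_powr)
        (simp add: powr_add[symmetric] algebra_simps)
    finally have "(\<Sum>k. ennreal (c k * (pi * 2 powr (- real k)))) = ennreal (\<Sum>k. c k * (pi * 2 powr (- real k)))"
      by (intro suminf_ennreal2) (auto simp: c_def)
    then show ?thesis by simp
  qed
  finally show ?thesis .
qed

text \<open>The substitution \<open>z = (w + a) / (1 + cnj a * w)\<close> turns the kernel into a bounded factor.\<close>

lemma nn_integral_kernel_bound:
  assumes a: "a \<in> unit_disk" and q: "2 * (\<alpha> + 2) \<le> q"
  shows "(\<integral>\<^sup>+z\<in>unit_disk. ennreal ((1 - (cmod z)\<^sup>2) powr \<alpha> * cmod (1 - cnj a * z) powr (- q)) \<partial>lborel) \<le>
    ennreal ((1 - (cmod a)\<^sup>2) powr (\<alpha> + 2 - q) * 2 powr (q - 2 * \<alpha> - 4)) *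
      (\<integral>\<^sup>+z\<in>unit_disk. ennreal ((1 - (cmod z)\<^sup>2) powr \<alpha>) \<partial>lborel)"
proof -
  define \<delta> where "\<delta> = 1 - (cmod a)\<^sup>2"
  have \<delta>: "\<delta> > 0" using one_minus_cmod_sq(3)[OF a] by (simp add: \<delta>_def)
  have \<delta>c: "of_real \<delta> = 1 - cnj a * a"
    by (simp only: \<delta>_def of_real_diff of_real_1 complex_norm_square mult.commute)
  define \<sigma> where "\<sigma> = Moebius_function 0 (- a)"
  have \<sigma>: "\<sigma> z = (z + a) / (1 + cnj a * z)" for z
    by (simp add: \<sigma>_def Moebius_function_simple)
  have na: "cmod a < 1" using a by simp
  have bij: "\<sigma> (Moebius_function 0 a z) = z" "Moebius_function 0 a (\<sigma> z) = z" "\<sigma> z \<in> unit_disk"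
      "Moebius_function 0 a z \<in> unit_disk" if "z \<in> unit_disk" for z
    using that na Moebius_function_compose[of "-a" a z] Moebius_function_compose[of a "-a" z]
      Moebius_function_norm_lt_1[of "-a" z 0] Moebius_function_norm_lt_1[of a z 0]
    by (auto simp: \<sigma>_def)
  have inj: "inj_on \<sigma> unit_disk" using bij(2) by (metis inj_onI)
  have im: "\<sigma> ` unit_disk = unit_disk" using bij by (metis image_eqI subsetI image_subsetI subset_antisym)
  have hol: "\<sigma> holomorphic_on unit_disk"
    using Moebius_function_holomorphic[of "-a" 0] na by (simp add: \<sigma>_def)
  have nz: "0 < cmod (1 + cnj a * z)" "cmod (1 + cnj a * z) \<le> 2" "1 + cnj a * z \<noteq> 0" if "z \<in> unit_disk" for z
  proof -
    have "cmod (cnj a * z) < 1" using na that by (simp add: norm_mult) (metis mult_le_one mult_strict_mono' norm_ge_zero mult_1)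
    then show "cmod (1 + cnj a * z) \<le> 2" using norm_triangle_ineq[of 1 "cnj a * z"] by simp
    have "1 + cnj a * z = 0 \<Longrightarrow> cmod (cnj a * z) = 1"
      by (metis add_eq_0_iff norm_minus_cancel norm_one)
    then show "1 + cnj a * z \<noteq> 0" using \<open>cmod (cnj a * z) < 1\<close> by auto
    then show "0 < cmod (1 + cnj a * z)" by simp
  qed
  define F where "F z = (1 - (cmod z)\<^sup>2) powr \<alpha> * cmod (1 - cnj a * z) powr (- q)" for z
  have le: "F (\<sigma> z) * (cmod (deriv \<sigma> z))\<^sup>2 \<le> \<delta> powr (\<alpha> + 2 - q) * 2 powr (q - 2 * \<alpha> - 4) * (1 - (cmod z)\<^sup>2) powr \<alpha>"
    if z: "z \<in> unit_disk" for z
  proof -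
    define y where "y = cmod (1 + cnj a * z)"
    define x where "x = 1 - (cmod z)\<^sup>2"
    have y: "0 < y" "y \<le> 2" using nz[OF z] by (auto simp: y_def)
    have x: "0 < x" using one_minus_cmod_sq(3)[OF z] by (simp add: x_def)
    have "(\<sigma> has_field_derivative (of_real \<delta> / (1 + cnj a * z)\<^sup>2)) (at z)"
      unfolding \<sigma> using nz(3)[OF z]
      by (auto intro!: derivative_eq_intros simp: \<delta>c power2_eq_square field_simps)
    then have d: "cmod (deriv \<sigma> z) = \<delta> / y\<^sup>2"
      using \<delta> by (simp add: DERIV_imp_deriv norm_divide norm_power y_def)
    have "1 - cnj a * \<sigma> z = of_real \<delta> / (1 + cnj a * z)"
      using nz(3)[OF z] by (simp add: \<sigma> \<delta>c field_simps)
    then have k: "cmod (1 - cnj a * \<sigma> z) = \<delta> / y"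
      using \<delta> by (simp add: norm_divide y_def)
    \<comment> \<open>The invariance identity behind the Schwarz-Pick lemma. It is proved over the
      complex numbers, with squared moduli written as products with conjugates, so that it becomes
      field algebra.\<close>
    have "of_real (1 - (cmod (\<sigma> z))\<^sup>2) = (of_real (\<delta> * x / y\<^sup>2) :: complex)"
    proof -
      define u where "u = 1 + cnj a * z"
      have "u \<noteq> 0" using nz(3)[OF z] by (simp add: u_def)
      then have u: "u \<noteq> 0" "cnj u \<noteq> 0" by simp_all
      have "1 - \<sigma> z * cnj (\<sigma> z) = (u * cnj u - (z + a) * (cnj z + cnj a)) / (u * cnj u)"
      proof -
        have eq: "\<sigma> z = (z + a) / u" by (simp add: \<sigma> u_def)
        show ?thesis using u unfolding eq by (simp add: field_simps)
      qed
      also have "u * cnj u - (z + a) * (cnj z + cnj a) = (1 - cnj a * a) * (1 - z * cnj z)"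
        by (simp add: u_def algebra_simps)
      finally have "1 - \<sigma> z * cnj (\<sigma> z) = ((1 - cnj a * a) * (1 - z * cnj z)) / ((1 + cnj a * z) * cnj (1 + cnj a * z))"
        by (simp only: u_def)
      then show ?thesis
        by (simp only: of_real_diff of_real_divide of_real_mult \<delta>c x_def y_def of_real_1 complex_norm_square)
    qed
    then have w: "1 - (cmod (\<sigma> z))\<^sup>2 = \<delta> * x / y\<^sup>2" by (simp only: of_real_eq_iff)
    have y2: "(y\<^sup>2) powr \<alpha> = y powr (2 * \<alpha>)"
      using y powr_powr[of y 2 \<alpha>] by simp
    have "F (\<sigma> z) * (cmod (deriv \<sigma> z))\<^sup>2 = (\<delta> * x / y\<^sup>2) powr \<alpha> * (\<delta> / y) powr (- q) * (\<delta> / y\<^sup>2)\<^sup>2"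
      by (simp add: F_def w k d)
    also have "\<dots> = (\<delta> powr \<alpha> * \<delta> powr (- q) * \<delta>\<^sup>2) * x powr \<alpha> * (1 / (y powr (2 * \<alpha>) * y powr (- q) * y ^ 4))"
      using x y \<delta> by (simp add: powr_divide powr_mult y2 power_divide)
    also have "\<delta> powr \<alpha> * \<delta> powr (- q) * \<delta>\<^sup>2 = \<delta> powr (\<alpha> + 2 - q)"
    proof -
      have "\<delta>\<^sup>2 = \<delta> powr 2" using \<delta> by simp
      then show ?thesis by (simp only: powr_add[symmetric]) (simp add: algebra_simps)
    qed
    also have "1 / (y powr (2 * \<alpha>) * y powr (- q) * y ^ 4) = y powr (q - 2 * \<alpha> - 4)"
    proof -
      have "y ^ 4 = y powr 4" using y by simp
      then have "1 / (y powr (2 * \<alpha>) * y powr (- q) * y ^ 4) = 1 / y powr (2 * \<alpha> - q + 4)"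
        by (simp only: powr_add[symmetric]) simp
      also have "\<dots> = y powr (- (2 * \<alpha> - q + 4))" by (rule powr_minus_divide[symmetric])
      finally show ?thesis by (simp add: algebra_simps)
    qed
    \<comment> \<open>The hypothesis on \<open>q\<close> makes the exponent of \<open>y\<close>
      nonnegative, so the upper bound \<open>y <= 2\<close> is enough.\<close>
    also have "\<delta> powr (\<alpha> + 2 - q) * x powr \<alpha> * y powr (q - 2 * \<alpha> - 4) \<le>
        \<delta> powr (\<alpha> + 2 - q) * x powr \<alpha> * 2 powr (q - 2 * \<alpha> - 4)"
      using y q by (intro mult_left_mono powr_mono2) auto
    finally show ?thesis by (simp add: x_def mult_ac)
  qed
  have [measurable]: "unit_disk \<in> sets borel" by simp
  have "(\<integral>\<^sup>+z\<in>unit_disk. ennreal (F z) \<partial>lborel) = (\<integral>\<^sup>+z\<in>\<sigma> ` unit_disk. ennreal (F z) \<partial>lborel)"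
    by (simp add: im)
  also have "\<dots> = (\<integral>\<^sup>+z\<in>unit_disk. ennreal (F (\<sigma> z) * (cmod (deriv \<sigma> z))\<^sup>2) \<partial>lborel)"
  proof (rule nn_integral_holomorphic_image[OF open_ball hol inj])
    show "F \<in> borel_measurable borel" unfolding F_def by measurable
  qed (simp add: F_def)
  also have "\<dots> \<le> (\<integral>\<^sup>+z. ennreal (\<delta> powr (\<alpha> + 2 - q) * 2 powr (q - 2 * \<alpha> - 4)) * (ennreal ((1 - (cmod z)\<^sup>2) powr \<alpha>) * indicator unit_disk z) \<partial>lborel)"
    using le by (intro nn_integral_mono) (auto simp: indicator_def ennreal_mult[symmetric] intro!: ennreal_leI)
  also have "\<dots> = ennreal (\<delta> powr (\<alpha> + 2 - q) * 2 powr (q - 2 * \<alpha> - 4)) *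
      (\<integral>\<^sup>+z\<in>unit_disk. ennreal ((1 - (cmod z)\<^sup>2) powr \<alpha>) \<partial>lborel)"
    by (rule nn_integral_cmult) measurable
  finally show ?thesis by (simp add: F_def \<delta>_def)
qed


subsection \<open>Test functions\<close>

lemma bergmanI:
  assumes p: "1 \<le> p" and \<alpha>: "-1 < \<alpha>" and f: "f \<in> hol_disk" and B: "0 \<le> B"
    and bd: "bergman_integral p \<alpha> f \<le> ennreal B"
  shows "f \<in> bergman p \<alpha>" "bergman_norm p \<alpha> f \<le> B powr (1 / p)"
proof -
  show "f \<in> bergman p \<alpha>"
    using f bd by (auto simp: bergman_def intro: le_less_trans)
  have "enn2real (bergman_integral p \<alpha> f) \<le> B"
    using bd B by (simp add: enn2real_leI)
  then show "bergman_norm p \<alpha> f \<le> B powr (1 / p)"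
    using p unfolding bergman_norm_def by (intro powr_mono2) auto
qed

lemma bounded_imp_bergman:
  assumes p: "1 \<le> p" and \<alpha>: "-1 < \<alpha>" and f: "f \<in> hol_disk" and bd: "\<And>z. z \<in> unit_disk \<Longrightarrow> cmod (f z) \<le> 1"
  shows "f \<in> bergman p \<alpha>"
proof -
  note [measurable] = hol_disk_measurable[OF f]
  have "(\<integral>\<^sup>+z\<in>unit_disk. ennreal (cmod (f z) powr p * (1 - (cmod z)\<^sup>2) powr \<alpha>) \<partial>lborel) \<le>
      (\<integral>\<^sup>+z\<in>unit_disk. ennreal ((1 - (cmod z)\<^sup>2) powr \<alpha>) \<partial>lborel)"
  proof (intro nn_integral_mono)
    fix z
    have "cmod (f z) powr p * (1 - (cmod z)\<^sup>2) powr \<alpha> \<le> 1 * (1 - (cmod z)\<^sup>2) powr \<alpha>" if "z \<in> unit_disk"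
      using bd[OF that] p powr_mono2[of p "cmod (f z)" 1] by (intro mult_right_mono) auto
    then show "ennreal (cmod (f z) powr p * (1 - (cmod z)\<^sup>2) powr \<alpha>) * indicator unit_disk z \<le>
        ennreal ((1 - (cmod z)\<^sup>2) powr \<alpha>) * indicator unit_disk z"
      by (auto simp: indicator_def intro: ennreal_leI)
  qed
  also have "\<dots> < \<infinity>" by (rule nn_integral_disk_weight_finite[OF \<alpha>])
  finally show ?thesis
    using f \<alpha> by (simp add: bergman_def bergman_integral_eq ennreal_mult_less_top)
qed

text \<open>At \<open>z = a\<close> the derivative vanishes for \<open>A = N + 1\<close>, \<open>B = - N\<close>, and the value vanishes for
  \<open>A = - 1\<close>, \<open>B = 1\<close>.\<close>

definition test_fun :: "nat \<Rightarrow> real \<Rightarrow> real \<Rightarrow> real \<Rightarrow> complex \<Rightarrow> complex \<Rightarrow> complex" where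
  "test_fun N s A B a = (\<lambda>z. if z \<in> unit_disk then
     of_real ((1 - (cmod a)\<^sup>2) powr (real N - s)) *
       (of_real A * inverse (1 - cnj a * z) ^ N +
        of_real B * of_real (1 - (cmod a)\<^sup>2) * inverse (1 - cnj a * z) ^ (N + 1)) else 0)"

lemma cmod_one_minus_cnj_mult:
  assumes "a \<in> unit_disk" "z \<in> unit_disk"
  shows "1 - cmod a \<le> cmod (1 - cnj a * z)" "1 - cmod z \<le> cmod (1 - cnj a * z)" "1 - cnj a * z \<noteq> 0"
proof -
  have le: "1 - cmod a * cmod z \<le> cmod (1 - cnj a * z)"
    using norm_triangle_ineq2[of 1 "cnj a * z"] by (simp add: norm_mult)
  moreover have "cmod a * cmod z \<le> cmod a * 1" "cmod a * cmod z \<le> 1 * cmod z"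
    using assms by (intro mult_left_mono mult_right_mono; simp)+
  ultimately show *: "1 - cmod a \<le> cmod (1 - cnj a * z)" "1 - cmod z \<le> cmod (1 - cnj a * z)" by linarith+
  then show "1 - cnj a * z \<noteq> 0" using assms by auto
qed

lemma test_fun_has_field_derivative:
  assumes a: "a \<in> unit_disk" and z: "z \<in> unit_disk"
  shows "(test_fun N s A B a has_field_derivative
     of_real ((1 - (cmod a)\<^sup>2) powr (real N - s)) * cnj a *
       (of_real (A * real N) * inverse (1 - cnj a * z) ^ (N + 1) +
        of_real (B * (real N + 1)) * of_real (1 - (cmod a)\<^sup>2) * inverse (1 - cnj a * z) ^ (N + 2))) (at z)"
proof -
  have pw: "((\<lambda>z. inverse (1 - cnj a * z) ^ n) has_field_derivative
      of_nat n * cnj a * inverse (1 - cnj a * z) ^ (n + 1)) (at z)" for n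
  proof -
    have "((\<lambda>z. inverse (1 - cnj a * z)) has_field_derivative cnj a * inverse (1 - cnj a * z) ^ 2) (at z)"
      using cmod_one_minus_cnj_mult(3)[OF a z]
      by (auto intro!: derivative_eq_intros simp: power2_eq_square)
    from DERIV_power[OF this, of n] show ?thesis
      by (rule DERIV_cong) (cases n; simp add: power2_eq_square)
  qed
  have "((\<lambda>z. of_real ((1 - (cmod a)\<^sup>2) powr (real N - s)) *
       (of_real A * inverse (1 - cnj a * z) ^ N +
        of_real B * of_real (1 - (cmod a)\<^sup>2) * inverse (1 - cnj a * z) ^ (N + 1))) has_field_derivative
     of_real ((1 - (cmod a)\<^sup>2) powr (real N - s)) *
       (of_real A * (of_nat N * cnj a * inverse (1 - cnj a * z) ^ (N + 1)) +
        of_real B * of_real (1 - (cmod a)\<^sup>2) * (of_nat (N + 1) * cnj a * inverse (1 - cnj a * z) ^ (N + 1 + 1)))) (at z)"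
    by (intro DERIV_cmult DERIV_add pw)
  then have "(test_fun N s A B a has_field_derivative
     of_real ((1 - (cmod a)\<^sup>2) powr (real N - s)) *
       (of_real A * (of_nat N * cnj a * inverse (1 - cnj a * z) ^ (N + 1)) +
        of_real B * of_real (1 - (cmod a)\<^sup>2) * (of_nat (N + 1) * cnj a * inverse (1 - cnj a * z) ^ (N + 1 + 1)))) (at z)"
    by (rule has_field_derivative_transform_within_open[OF _ open_ball z]) (simp add: test_fun_def)
  then show ?thesis
    by (rule DERIV_cong) (simp add: algebra_simps)
qed

lemma test_fun_hol_disk:
  assumes "a \<in> unit_disk"
  shows "test_fun N s A B a \<in> hol_disk"
proof -
  have "test_fun N s A B a holomorphic_on unit_disk"
    unfolding holomorphic_on_open[OF open_ball] using test_fun_has_field_derivative[OF assms] by blast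
  then show ?thesis by (simp add: hol_disk_def test_fun_def)
qed

lemma inverse_one_minus_cnj_mult_self:
  assumes "a \<in> unit_disk"
  shows "inverse (1 - cnj a * a) = of_real (1 / (1 - (cmod a)\<^sup>2))"
proof -
  have "1 - cnj a * a = of_real (1 - (cmod a)\<^sup>2)"
    by (simp only: of_real_diff of_real_1 complex_norm_square mult.commute)
  then show ?thesis by (simp add: inverse_eq_divide)
qed

text \<open>On the diagonal the denominator \<open>1 - cnj a * a\<close> equals \<open>d\<close>, so
  \<open>N\<close> cancels from the exponents and both growth rates are attained. For the two
  choices of \<open>(A, B)\<close> named above, the coefficient pairs of value and derivative are
  \<open>(1, 0)\<close> and \<open>(0, 1)\<close>.\<close>

lemma test_fun_at:
  assumes a: "a \<in> unit_disk"
  defines "d \<equiv> 1 - (cmod a)\<^sup>2"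
  shows "test_fun N s A B a a = of_real ((A + B) * d powr (- s))"
    and "deriv (test_fun N s A B a) a = cnj a * of_real ((A * real N + B * (real N + 1)) * d powr (- (s + 1)))"
proof -
  have d: "d > 0" using one_minus_cmod_sq(3)[OF a] by (simp add: d_def)
  have inv: "inverse (1 - cnj a * a) ^ n = of_real (d powr (- real n))" for n
    unfolding inverse_one_minus_cnj_mult_self[OF a] using d
    by (simp add: d_def[symmetric] powr_minus powr_realpow power_divide inverse_eq_divide)
  have e: "d * d powr (- real (Suc n)) = d powr (- real n)" for n
    using d by (simp add: powr_mult_base)
  have "test_fun N s A B a a = of_real (d powr (real N - s) * (A * d powr (- real N) + B * d * d powr (- real (N + 1))))"
    using a unfolding test_fun_def inv d_def[symmetric] by simp
  also have "d powr (real N - s) * (A * d powr (- real N) + B * d * d powr (- real (N + 1))) =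
      (A + B) * (d powr (real N - s) * d powr (- real N))"
    using e[of N] by (simp add: algebra_simps)
  also have "d powr (real N - s) * d powr (- real N) = d powr (- s)"
    using d by (simp flip: powr_add)
  finally show "test_fun N s A B a a = of_real ((A + B) * d powr (- s))" .
  have "deriv (test_fun N s A B a) a = cnj a * of_real (d powr (real N - s) *
     (A * real N * d powr (- real (N + 1)) + B * (real N + 1) * d * d powr (- real (N + 2))))"
    using DERIV_imp_deriv[OF test_fun_has_field_derivative[OF a a, of N s A B]]
    unfolding inv d_def[symmetric] by simp
  also have "d powr (real N - s) * (A * real N * d powr (- real (N + 1)) + B * (real N + 1) * d * d powr (- real (N + 2))) =
     (A * real N + B * (real N + 1)) * (d powr (real N - s) * d powr (- real (N + 1)))"
    using e[of "N + 1"] by (simp add: algebra_simps)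
  also have "d powr (real N - s) * d powr (- real (N + 1)) = d powr (- (s + 1))"
    using d by (simp flip: powr_add)
  finally show "deriv (test_fun N s A B a) a = cnj a * of_real ((A * real N + B * (real N + 1)) * d powr (- (s + 1)))" .
qed

text \<open>For fixed \<open>z\<close> the kernels are bounded uniformly in \<open>a\<close> by
  powers of \<open>1 / (1 - |z|)\<close>. The prefactor then forces convergence to 0 as
  \<open>|a|\<close> tends to 1 whenever \<open>N > s\<close>.\<close>

lemma test_fun_small:
  assumes z: "z \<in> unit_disk"
  obtains C where "\<And>a. a \<in> unit_disk \<Longrightarrow> cmod (test_fun N s A B a z) \<le> C * (1 - (cmod a)\<^sup>2) powr (real N - s)"
    and "\<And>a. a \<in> unit_disk \<Longrightarrow> cmod (deriv (test_fun N s A B a) z) \<le> C * (1 - (cmod a)\<^sup>2) powr (real N - s)"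
proof -
  define y where "y = 1 / (1 - cmod z)"
  have y: "y > 0" using z by (simp add: y_def)
  have inv: "cmod (inverse (1 - cnj a * z) ^ n) \<le> y ^ n" if "a \<in> unit_disk" for a n
  proof -
    have "inverse (cmod (1 - cnj a * z)) \<le> inverse (1 - cmod z)"
      using cmod_one_minus_cnj_mult(2)[OF that z] z by (intro le_imp_inverse_le) auto
    then show ?thesis
      unfolding norm_power norm_inverse y_def by (intro power_mono) (auto simp: inverse_eq_divide)
  qed
  have d: "cmod (of_real (1 - (cmod a)\<^sup>2)) \<le> 1" if "a \<in> unit_disk" for a
    using one_minus_cmod_sq(3)[OF that] by (simp only: norm_of_real) simp
  have bnd: "cmod (of_real P * inverse (1 - cnj a * z) ^ m + of_real Q * of_real (1 - (cmod a)\<^sup>2) * inverse (1 - cnj a * z) ^ n)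
      \<le> \<bar>P\<bar> * y ^ m + \<bar>Q\<bar> * 1 * y ^ n" if a: "a \<in> unit_disk" for a P Q m n
  proof -
    have "cmod (of_real P * inverse (1 - cnj a * z) ^ m) \<le> \<bar>P\<bar> * y ^ m"
      unfolding norm_mult norm_of_real by (intro mult_left_mono inv[OF a]) auto
    moreover have "cmod (of_real Q * of_real (1 - (cmod a)\<^sup>2) * inverse (1 - cnj a * z) ^ n) \<le> \<bar>Q\<bar> * 1 * y ^ n"
      unfolding norm_mult norm_of_real[of Q] using y
      by (intro mult_mono order_refl inv[OF a] d[OF a]) auto
    ultimately show ?thesis by (rule norm_triangle_le[OF add_mono])
  qed
  define C1 where "C1 = \<bar>A\<bar> * y ^ N + \<bar>B\<bar> * 1 * y ^ (N + 1)"
  define C2 where "C2 = \<bar>A * real N\<bar> * y ^ (N + 1) + \<bar>B * (real N + 1)\<bar> * 1 * y ^ (N + 2)"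
  have "cmod (test_fun N s A B a z) \<le> (1 - (cmod a)\<^sup>2) powr (real N - s) * C1" if a: "a \<in> unit_disk" for a
    using bnd[OF a, of A N B "N + 1"] z unfolding C1_def[symmetric]
    by (simp add: test_fun_def norm_mult mult_left_mono del: of_real_diff of_real_power power_Suc)
  moreover have "cmod (deriv (test_fun N s A B a) z) \<le> (1 - (cmod a)\<^sup>2) powr (real N - s) * (1 * C2)" if a: "a \<in> unit_disk" for a
  proof -
    define E where "E = of_real (A * real N) * inverse (1 - cnj a * z) ^ (N + 1) +
        of_real (B * (real N + 1)) * of_real (1 - (cmod a)\<^sup>2) * inverse (1 - cnj a * z) ^ (N + 2)"
    have "cmod E \<le> C2" unfolding E_def C2_def by (rule bnd[OF a])
    then have "cmod (cnj a) * cmod E \<le> 1 * C2" using a by (intro mult_mono) auto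
    then show ?thesis
      unfolding DERIV_imp_deriv[OF test_fun_has_field_derivative[OF a z, of N s A B]] E_def[symmetric]
      by (simp add: norm_mult mult_left_mono mult.assoc)
  qed
  moreover have "0 \<le> C1" "0 \<le> C2" using y by (auto simp: C1_def C2_def)
  moreover have "x * C1 \<le> (C1 + C2) * x" "x * (1 * C2) \<le> (C1 + C2) * x" if "0 \<le> C1" "0 \<le> C2" "x \<ge> 0" for x
    using that by (auto simp: algebra_simps)
  ultimately show thesis
    by (intro that[of "C1 + C2"]) (meson order_trans powr_ge_zero)+
qed

text \<open>The condition on \<open>N\<close> says that \<open>q = N * p\<close> meets the
  hypothesis of the kernel integral bound. The power of \<open>d\<close> from that bound is the
  reciprocal of the one from the normalisation, so the estimate is uniform in
  \<open>a\<close>.\<close>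

lemma test_fun_bergman:
  assumes p: "1 \<le> p" and \<alpha>: "-1 < \<alpha>" and s: "s = (2 + \<alpha>) / p" and N: "2 * s \<le> real N"
  obtains M where "\<And>a. a \<in> unit_disk \<Longrightarrow> test_fun N s A B a \<in> bergman p \<alpha>"
    and "\<And>a. a \<in> unit_disk \<Longrightarrow> bergman_norm p \<alpha> (test_fun N s A B a) \<le> M"
proof -
  define I0 where "I0 = enn2real (\<integral>\<^sup>+z\<in>unit_disk. ennreal ((1 - (cmod z)\<^sup>2) powr \<alpha>) \<partial>lborel)"
  have I0: "(\<integral>\<^sup>+z\<in>unit_disk. ennreal ((1 - (cmod z)\<^sup>2) powr \<alpha>) \<partial>lborel) = ennreal I0" "0 \<le> I0"
    using nn_integral_disk_weight_finite[OF \<alpha>] by (auto simp: I0_def)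
  define q where "q = real N * p"
  have q: "2 * (\<alpha> + 2) \<le> q" using N p by (simp add: q_def s field_simps)
  \<comment> \<open>The factor 2 comes from \<open>d / |1 - cnj a * z| <= 2\<close>, which reduces
    the second kernel term to the first.\<close>
  define c where "c = \<bar>A\<bar> + 2 * \<bar>B\<bar>"
  define B' where "B' = (\<alpha> + 1) / pi * (c powr p * (2 powr (q - 2 * \<alpha> - 4) * I0))"
  have B': "0 \<le> B'" using \<alpha> I0(2) by (simp add: B'_def)
  have "bergman_integral p \<alpha> (test_fun N s A B a) \<le> ennreal B'" if a: "a \<in> unit_disk" for a
  proof -
    note hd = test_fun_hol_disk[OF a, of N s A B]
    note [measurable] = hol_disk_measurable[OF hd]
    have [measurable]: "unit_disk \<in> sets borel" by simp
    define d where "d = 1 - (cmod a)\<^sup>2"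
    have d: "d > 0" "d \<le> 2 * (1 - cmod a)" using one_minus_cmod_sq[OF a] by (auto simp: d_def)
    have le: "cmod (test_fun N s A B a z) powr p \<le> c powr p * d powr (q - \<alpha> - 2) * cmod (1 - cnj a * z) powr (- q)"
      if z: "z \<in> unit_disk" for z
    proof -
      define y where "y = cmod (1 - cnj a * z)"
      have y: "0 < y" "d / y \<le> 2"
        using cmod_one_minus_cnj_mult[OF a z] d by (auto simp: y_def field_simps)
      define v where "v = 1 - cnj a * z"
      have "test_fun N s A B a z = of_real (d powr (real N - s)) * inverse v ^ N * (of_real A + of_real B * (of_real d * inverse v))"
        using z by (simp add: test_fun_def d_def v_def algebra_simps)
      then have "cmod (test_fun N s A B a z) = d powr (real N - s) * inverse y ^ N * cmod (of_real A + of_real B * (of_real d * inverse v))"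
        by (simp add: norm_mult norm_power norm_inverse y_def v_def)
      also have "\<dots> \<le> d powr (real N - s) * inverse y ^ N * c"
      proof (intro mult_left_mono)
        have "cmod (of_real A + of_real B * (of_real d * inverse v)) \<le> \<bar>A\<bar> + \<bar>B\<bar> * (d / y)"
          using d by (intro order_trans[OF norm_triangle_ineq]) (simp add: norm_mult norm_inverse y_def v_def divide_inverse)
        also have "\<dots> \<le> \<bar>A\<bar> + \<bar>B\<bar> * 2" by (intro add_left_mono mult_left_mono y) auto
        finally show "cmod (of_real A + of_real B * (of_real d * inverse v)) \<le> c" by (simp add: c_def)
      qed (use y in auto)
      also have "inverse y ^ N = y powr (- real N)"
        using y by (simp add: powr_minus powr_realpow power_inverse)
      finally have "cmod (test_fun N s A B a z) powr p \<le> (d powr (real N - s) * y powr (- real N) * c) powr p"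
        using p by (intro powr_mono2) auto
      also have "\<dots> = c powr p * d powr ((real N - s) * p) * y powr (- q)"
        by (simp add: powr_mult powr_powr q_def c_def)
      also have "(real N - s) * p = q - \<alpha> - 2"
      proof -
        have "s * p = 2 + \<alpha>" using p by (simp add: s)
        then show ?thesis by (simp add: q_def left_diff_distrib)
      qed
      finally show ?thesis by (simp add: y_def)
    qed
    have "(\<integral>\<^sup>+z\<in>unit_disk. ennreal (cmod (test_fun N s A B a z) powr p * (1 - (cmod z)\<^sup>2) powr \<alpha>) \<partial>lborel) \<le>
      (\<integral>\<^sup>+z. ennreal (c powr p * d powr (q - \<alpha> - 2)) * (ennreal ((1 - (cmod z)\<^sup>2) powr \<alpha> * cmod (1 - cnj a * z) powr (- q)) * indicator unit_disk z) \<partial>lborel)"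
    proof (intro nn_integral_mono)
      fix z
      show "ennreal (cmod (test_fun N s A B a z) powr p * (1 - (cmod z)\<^sup>2) powr \<alpha>) * indicator unit_disk z \<le>
        ennreal (c powr p * d powr (q - \<alpha> - 2)) * (ennreal ((1 - (cmod z)\<^sup>2) powr \<alpha> * cmod (1 - cnj a * z) powr (- q)) * indicator unit_disk z)"
      proof (cases "z \<in> unit_disk")
        case True
        from mult_right_mono[OF le[OF True], of "(1 - (cmod z)\<^sup>2) powr \<alpha>"]
        have "cmod (test_fun N s A B a z) powr p * (1 - (cmod z)\<^sup>2) powr \<alpha> \<le>
            (c powr p * d powr (q - \<alpha> - 2)) * ((1 - (cmod z)\<^sup>2) powr \<alpha> * cmod (1 - cnj a * z) powr (- q))"
          by (simp only: mult_ac powr_ge_zero simp_thms)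
        then show ?thesis
          using True by (simp only: ennreal_mult[OF mult_nonneg_nonneg[OF powr_ge_zero powr_ge_zero] mult_nonneg_nonneg[OF powr_ge_zero powr_ge_zero], symmetric]
            indicator_simps mult_1_right ennreal_leI)
      qed simp
    qed
    also have "\<dots> = ennreal (c powr p * d powr (q - \<alpha> - 2)) * (\<integral>\<^sup>+z\<in>unit_disk. ennreal ((1 - (cmod z)\<^sup>2) powr \<alpha> * cmod (1 - cnj a * z) powr (- q)) \<partial>lborel)"
      by (rule nn_integral_cmult) measurable
    also have "\<dots> \<le> ennreal (c powr p * d powr (q - \<alpha> - 2)) * (ennreal (d powr (\<alpha> + 2 - q) * 2 powr (q - 2 * \<alpha> - 4)) * ennreal I0)"
      unfolding I0(1)[symmetric] d_def by (intro mult_left_mono nn_integral_kernel_bound[OF a q]) simp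
    finally have "ennreal ((\<alpha> + 1) / pi) *
        (\<integral>\<^sup>+z\<in>unit_disk. ennreal (cmod (test_fun N s A B a z) powr p * (1 - (cmod z)\<^sup>2) powr \<alpha>) \<partial>lborel) \<le>
        ennreal ((\<alpha> + 1) / pi) * (ennreal (c powr p * d powr (q - \<alpha> - 2)) * (ennreal (d powr (\<alpha> + 2 - q) * 2 powr (q - 2 * \<alpha> - 4)) * ennreal I0))"
      by (rule mult_left_mono) simp
    also have "\<dots> = ennreal ((\<alpha> + 1) / pi * (c powr p * d powr (q - \<alpha> - 2) * (d powr (\<alpha> + 2 - q) * 2 powr (q - 2 * \<alpha> - 4) * I0)))"
      using \<alpha> I0(2) by (simp add: ennreal_mult[symmetric])
    also have "(\<alpha> + 1) / pi * (c powr p * d powr (q - \<alpha> - 2) * (d powr (\<alpha> + 2 - q) * 2 powr (q - 2 * \<alpha> - 4) * I0)) =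
      B' * (d powr (q - \<alpha> - 2) * d powr (\<alpha> + 2 - q))"
      by (simp add: B'_def)
    also have "d powr (q - \<alpha> - 2) * d powr (\<alpha> + 2 - q) = 1" using d by (simp flip: powr_add)
    finally show ?thesis
      using \<alpha> by (simp add: bergman_integral_eq)
  qed
  from bergmanI[OF p \<alpha> test_fun_hol_disk B' this]
  show thesis by (intro that[of "B' powr (1 / p)"])
qed


subsection \<open>The Bloch norms in the limsup conditions\<close>

lemma weighted_comp_has_field_derivative:
  assumes u: "u holomorphic_on unit_disk" and \<phi>: "\<phi> holomorphic_on unit_disk" "\<phi> ` unit_disk \<subseteq> unit_disk"
    and f: "f \<in> hol_disk" and z: "z \<in> unit_disk"
  shows "(weighted_comp u \<phi> f has_field_derivative
    deriv u z * f (\<phi> z) + u z * deriv \<phi> z * deriv f (\<phi> z)) (at z)"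
proof -
  have w: "\<phi> z \<in> unit_disk" using \<phi>(2) z by blast
  have du: "(u has_field_derivative deriv u z) (at z)"
    by (rule holomorphic_derivI[OF u open_ball z])
  have d\<phi>: "(\<phi> has_field_derivative deriv \<phi> z) (at z)"
    by (rule holomorphic_derivI[OF \<phi>(1) open_ball z])
  have "(f has_field_derivative deriv f (\<phi> z)) (at (\<phi> z))"
    using hol_disk_differentiable[OF f w] by (simp add: DERIV_deriv_iff_field_differentiable)
  from DERIV_mult[OF du DERIV_chain2[OF this d\<phi>]]
  have "((\<lambda>z. u z * f (\<phi> z)) has_field_derivative deriv u z * f (\<phi> z) + u z * deriv \<phi> z * deriv f (\<phi> z)) (at z)"
    by (rule DERIV_cong) (simp add: algebra_simps)
  then show ?thesis
    by (rule has_field_derivative_transform_within_open[OF _ open_ball z]) (simp add: weighted_comp_def)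
qed

lemma weighted_comp_hol_disk:
  assumes "u holomorphic_on unit_disk" "\<phi> holomorphic_on unit_disk" "\<phi> ` unit_disk \<subseteq> unit_disk" "f \<in> hol_disk"
  shows "weighted_comp u \<phi> f \<in> hol_disk"
proof -
  have "weighted_comp u \<phi> f holomorphic_on unit_disk"
    unfolding holomorphic_on_open[OF open_ball] using weighted_comp_has_field_derivative[OF assms] by blast
  then show ?thesis by (simp add: hol_disk_def weighted_comp_def)
qed

lemma deriv_integral_from_0:
  assumes F: "F holomorphic_on unit_disk" and z: "z \<in> unit_disk"
  shows "deriv (\<lambda>z. if z \<in> unit_disk then contour_integral (linepath 0 z) F else 0) z = F z"
proof -
  obtain G where G: "\<And>x. x \<in> unit_disk \<Longrightarrow> (G has_field_derivative F x) (at x within unit_disk)"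
    using holomorphic_convex_primitive'[OF convex_ball open_ball F] by blast
  have eq: "contour_integral (linepath 0 w) F = G w - G 0" if w: "w \<in> unit_disk" for w
  proof -
    have "path_image (linepath 0 w) \<subseteq> unit_disk"
      using w by (simp add: closed_segment_subset)
    from contour_integral_primitive[OF G valid_path_linepath this] show ?thesis
      by (simp add: contour_integral_unique)
  qed
  have "(G has_field_derivative F z) (at z)"
    using G[OF z] z by (simp add: at_within_open[OF _ open_ball])
  then have "((\<lambda>w. G w - G 0) has_field_derivative F z) (at z)"
    by (auto intro!: derivative_eq_intros)
  then have "((\<lambda>z. if z \<in> unit_disk then contour_integral (linepath 0 z) F else 0) has_field_derivative F z) (at z)"
    by (rule has_field_derivative_transform_within_open[OF _ open_ball z]) (simp add: eq)
  then show ?thesis by (rule DERIV_imp_deriv)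
qed

text \<open>The primitive vanishes at 0, so the point evaluation contributes nothing to the Bloch
  norm.\<close>

lemma bloch_enorm_integral_from_0:
  assumes F: "F holomorphic_on unit_disk"
  shows "bloch_enorm (\<lambda>z. if z \<in> unit_disk then contour_integral (linepath 0 z) F else 0) =
    (SUP z\<in>unit_disk. ennreal ((1 - (cmod z)\<^sup>2) * cmod (F z)))"
  unfolding bloch_enorm_def by (simp add: deriv_integral_from_0[OF F, simplified])

text \<open>Staying in \<open>ennreal\<close> postpones the question whether the supremum is finite.
  At \<open>j = 0\<close> the truncated exponent \<open>j - 1\<close> is 0, but the factor
  \<open>j\<close> annihilates the right side even if the supremum is infinite.\<close>

lemma bloch_enorm_I_op:
  assumes u: "u holomorphic_on unit_disk" and \<phi>: "\<phi> holomorphic_on unit_disk"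
  shows "bloch_enorm (I_op u (\<lambda>z. \<phi> z ^ j)) = ennreal (real j) *
    (SUP z\<in>unit_disk. ennreal ((1 - (cmod z)\<^sup>2) * cmod (u z * deriv \<phi> z) * cmod (\<phi> z) ^ (j - 1)))"
proof -
  have d: "deriv (\<lambda>z. \<phi> z ^ j) z = of_nat j * \<phi> z ^ (j - 1) * deriv \<phi> z" if "z \<in> unit_disk" for z
    using holomorphic_derivI[OF \<phi> open_ball that]
    by (intro DERIV_imp_deriv) (auto intro!: derivative_eq_intros)
  have hol: "(\<lambda>z. deriv (\<lambda>z. \<phi> z ^ j) z * u z) holomorphic_on unit_disk"
    by (intro holomorphic_intros holomorphic_deriv u \<phi> open_ball)
  have "ennreal ((1 - (cmod z)\<^sup>2) * cmod (deriv (\<lambda>z. \<phi> z ^ j) z * u z)) =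
      ennreal (real j) * ennreal ((1 - (cmod z)\<^sup>2) * cmod (u z * deriv \<phi> z) * cmod (\<phi> z) ^ (j - 1))" if "z \<in> unit_disk" for z
    using one_minus_cmod_sq(3)[OF that]
    by (simp add: d[OF that] norm_mult norm_power ennreal_mult[symmetric] mult_ac)
  then show ?thesis
    unfolding I_op_def bloch_enorm_integral_from_0[OF hol] SUP_mult_left_ennreal
    by (rule SUP_cong[OF refl])
qed

lemma bloch_enorm_J_op:
  assumes u: "u holomorphic_on unit_disk" and \<phi>: "\<phi> holomorphic_on unit_disk"
  shows "bloch_enorm (J_op u (\<lambda>z. \<phi> z ^ j)) =
    (SUP z\<in>unit_disk. ennreal ((1 - (cmod z)\<^sup>2) * cmod (deriv u z) * cmod (\<phi> z) ^ j))"
proof -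
  have hol: "(\<lambda>z. \<phi> z ^ j * deriv u z) holomorphic_on unit_disk"
    by (intro holomorphic_intros holomorphic_deriv u \<phi> open_ball)
  show ?thesis
    unfolding J_op_def bloch_enorm_integral_from_0[OF hol]
    by (intro SUP_cong) (simp_all add: norm_mult norm_power mult_ac)
qed

section \<open>Powers of the modulus against weights in the distance to the circle\<close>

text \<open>The maximum of \<open>t powr \<sigma> * exp (- t)\<close>, applied at \<open>t = j * (1 - x)\<close>.\<close>

lemma power_weight_bound:
  fixes x \<sigma> :: real
  assumes x: "0 \<le> x" "x < 1" and \<sigma>: "0 < \<sigma>" and j: "1 \<le> j"
  shows "real j powr \<sigma> * x ^ (j - 1) * (1 - x\<^sup>2) powr \<sigma> \<le> (2 * \<sigma>) powr \<sigma> * exp 1"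
proof -
  define t where "t = real j * (1 - x)"
  have t: "t > 0" using x j by (simp add: t_def)
  have "t / \<sigma> \<le> exp (t / \<sigma>)" using exp_ge_add_one_self[of "t / \<sigma>"] by linarith
  then have "(t / \<sigma>) powr \<sigma> \<le> exp (t / \<sigma>) powr \<sigma>"
    using t \<sigma> by (intro powr_mono2) auto
  then have t1: "t powr \<sigma> \<le> \<sigma> powr \<sigma> * exp t"
    using t \<sigma> by (simp add: powr_divide exp_powr_real field_simps)
  have "x ^ (j - 1) \<le> exp (x - 1) ^ (j - 1)"
    using x exp_ge_add_one_self[of "x - 1"] by (intro power_mono) auto
  also have "\<dots> = exp (1 - x) * exp (- t)"
    using j by (simp add: exp_of_nat_mult[symmetric] exp_add[symmetric] t_def of_nat_diff algebra_simps)
  also have "\<dots> \<le> exp 1 * exp (- t)" using x by (intro mult_right_mono) auto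
  finally have x1: "x ^ (j - 1) \<le> exp 1 * exp (- t)" .
  have "1 - x\<^sup>2 = (1 - x) * (1 + x)" by (simp add: power2_eq_square algebra_simps)
  also have "\<dots> \<le> (1 - x) * 2" using x by (intro mult_left_mono) auto
  finally have "(1 - x\<^sup>2) powr \<sigma> \<le> ((1 - x) * 2) powr \<sigma>"
    using x \<sigma> by (intro powr_mono2) (auto simp: power_le_one)
  also have "\<dots> = 2 powr \<sigma> * (1 - x) powr \<sigma>" using x by (simp only: powr_mult mult.commute)
  finally have y1: "(1 - x\<^sup>2) powr \<sigma> \<le> 2 powr \<sigma> * (1 - x) powr \<sigma>" .
  have "real j powr \<sigma> * x ^ (j - 1) * (1 - x\<^sup>2) powr \<sigma> \<le>
      real j powr \<sigma> * (exp 1 * exp (- t)) * (2 powr \<sigma> * (1 - x) powr \<sigma>)"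
    using x by (intro mult_mono x1 y1) auto
  also have "\<dots> = 2 powr \<sigma> * exp 1 * exp (- t) * t powr \<sigma>"
    using x by (simp add: t_def powr_mult)
  also have "\<dots> \<le> 2 powr \<sigma> * exp 1 * exp (- t) * (\<sigma> powr \<sigma> * exp t)"
    by (intro mult_left_mono t1) auto
  also have "\<dots> = (2 * \<sigma>) powr \<sigma> * exp 1 * (exp (- t) * exp t)"
    using \<sigma> by (simp add: powr_mult)
  also have "exp (- t) * exp t = 1" by (simp flip: exp_add)
  finally show ?thesis by simp
qed

lemma limsup_ennreal_eq_0_iff:
  fixes X :: "nat \<Rightarrow> ennreal"
  shows "limsup X = 0 \<longleftrightarrow> (\<forall>e>0. eventually (\<lambda>j. X j \<le> ennreal e) sequentially)"
proof
  assume "limsup X = 0"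
  then have "(X \<longlongrightarrow> 0) sequentially" by (rule tendsto_0_if_Limsup_eq_0_ennreal)
  then have "eventually (\<lambda>j. X j < ennreal e) sequentially" if "0 < e" for e
    by (rule order_tendstoD(2)) (use that in simp)
  then show "\<forall>e>0. eventually (\<lambda>j. X j \<le> ennreal e) sequentially"
    by (meson eventually_mono less_imp_le)
next
  assume *: "\<forall>e>0. eventually (\<lambda>j. X j \<le> ennreal e) sequentially"
  have "(X \<longlongrightarrow> 0) sequentially"
  proof (rule order_tendstoI)
    fix y :: ennreal assume "0 < y"
    then obtain w where w: "0 < w" "w < y" by (metis dense)
    then obtain e where e: "w = ennreal e" by (cases w) auto
    with w have "0 < e" by simp
    with * have "eventually (\<lambda>j. X j \<le> ennreal e) sequentially" by blast
    then show "eventually (\<lambda>j. X j < y) sequentially"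
      using w e by (auto elim!: eventually_mono)
  qed simp
  then show "limsup X = 0" by (simp add: lim_imp_Limsup)
qed

text \<open>A supremum over all points for each \<open>j\<close> is traded for a condition at each
  point. From left to right, every point gets its own \<open>j\<close>, of size about
  \<open>1 / (1 - x)\<close>. From right to left, points with \<open>x\<close> near 1 are handled by
  \<open>power_weight_bound\<close>, and elsewhere the powers decay faster than any power of
  \<open>j\<close>.\<close>

lemma limsup_power_weight_iff:
  fixes v x :: "complex \<Rightarrow> real"
  assumes v: "\<And>z. z \<in> S \<Longrightarrow> 0 \<le> v z" "\<And>z. z \<in> S \<Longrightarrow> v z \<le> M"
    and x: "\<And>z. z \<in> S \<Longrightarrow> 0 \<le> x z" "\<And>z. z \<in> S \<Longrightarrow> x z < 1" and \<sigma>: "0 < \<sigma>"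
  shows "limsup (\<lambda>j. ennreal (real j powr \<sigma>) * (SUP z\<in>S. ennreal (v z * x z ^ (j - 1)))) = 0 \<longleftrightarrow>
    (\<forall>\<epsilon>>0. \<exists>\<rho><1. \<forall>z\<in>S. \<rho> < x z \<longrightarrow> v z \<le> \<epsilon> * (1 - (x z)\<^sup>2) powr \<sigma>)" (is "?L \<longleftrightarrow> ?R")
proof -
  have le_iff: "ennreal (real j powr \<sigma>) * (SUP z\<in>S. ennreal (v z * x z ^ (j - 1))) \<le> ennreal e \<longleftrightarrow>
      (\<forall>z\<in>S. real j powr \<sigma> * (v z * x z ^ (j - 1)) \<le> e)" if "0 < e" for e j
    using that v x by (auto simp: SUP_mult_left_ennreal SUP_le_iff ennreal_mult[symmetric])
  show ?thesis
  proof
    assume ?L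
    show ?R
    proof (intro allI impI)
      fix \<epsilon> :: real assume \<epsilon>: "0 < \<epsilon>"
      \<comment> \<open>\<open>exp (-2)\<close> is the lower bound for \<open>y ^ (j - 1)\<close> at
        the chosen \<open>j\<close>, so this loss is paid in advance.\<close>
      define e where "e = \<epsilon> * exp (- 2)"
      have e: "0 < e" using \<epsilon> by (simp add: e_def)
      then have "eventually (\<lambda>j. \<forall>z\<in>S. real j powr \<sigma> * (v z * x z ^ (j - 1)) \<le> e) sequentially"
        using \<open>?L\<close> unfolding limsup_ennreal_eq_0_iff le_iff[OF e, symmetric] by blast
      then obtain n where n: "\<And>j z. n \<le> j \<Longrightarrow> z \<in> S \<Longrightarrow> real j powr \<sigma> * (v z * x z ^ (j - 1)) \<le> e"
        unfolding eventually_sequentially by blast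
      have "v z \<le> \<epsilon> * (1 - (x z)\<^sup>2) powr \<sigma>" if z: "z \<in> S" and \<rho>: "max (1 / 2) (1 - 1 / (real n + 1)) < x z" for z
      proof -
        define y where "y = x z"
        have y: "1 / 2 < y" "1 - 1 / (real n + 1) < y" "y < 1" using \<rho> x(2)[OF z] by (auto simp: y_def)
        \<comment> \<open>At this scale \<open>j powr \<sigma>\<close> is at least
          \<open>(1 - y) powr (-\<sigma>)\<close> while \<open>y ^ (j - 1)\<close> stays bounded
          below. The requirement on \<open>y\<close> makes \<open>1 / (1 - y)\<close> exceed
          \<open>n\<close>, hence \<open>n <= j\<close>.\<close>
        define j where "j = nat \<lceil>1 / (1 - y)\<rceil>"
        have "real n + 1 < 1 / (1 - y)" "1 < 1 / (1 - y)" using y by (auto simp: field_simps)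
        then have j: "1 / (1 - y) \<le> real j" "real j - 1 \<le> 1 / (1 - y)" "n \<le> j" "1 \<le> j"
          unfolding j_def by linarith+
        \<comment> \<open>With \<open>j - 1 <= 1 / (1 - y)\<close> this gives
          \<open>(j - 1) * ln y >= - 1 / y\<close>, which is at least -2 because
          \<open>y > 1/2\<close>.\<close>
        have "1 - 1 / y \<le> ln y"
          using ln_le_minus_one[of "1 / y"] y by (simp add: ln_div)
        then have "(real j - 1) * (1 - 1 / y) \<le> (real j - 1) * ln y"
          using j by (intro mult_left_mono) auto
        moreover have "(real j - 1) * (1 / y - 1) \<le> 1 / (1 - y) * (1 / y - 1)"
          using j y by (intro mult_right_mono) (auto simp: field_simps)
        moreover have "1 / (1 - y) * (1 / y - 1) = 1 / y" using y by (simp add: field_simps)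
        moreover have "1 / y \<le> 2" using y by (simp add: field_simps)
        ultimately have "- 2 \<le> (real j - 1) * ln y" by (simp add: algebra_simps)
        then have "exp (- 2) \<le> exp ((real j - 1) * ln y)" by simp
        also have "\<dots> = y ^ (j - 1)"
          using y j by (subst powr_realpow[symmetric]) (auto simp: powr_def of_nat_diff)
        finally have y1: "exp (- 2) \<le> y ^ (j - 1)" .
        have "(1 / (1 - y)) powr \<sigma> \<le> real j powr \<sigma>" using j y \<sigma> by (intro powr_mono2) auto
        then have "(1 / (1 - y)) powr \<sigma> * (v z * exp (- 2)) \<le> real j powr \<sigma> * (v z * y ^ (j - 1))"
          using v(1)[OF z] y1 by (intro mult_mono mult_left_mono) auto
        also have "\<dots> \<le> \<epsilon> * exp (- 2)" using n[OF j(3) z] by (simp add: y_def e_def)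
        finally have "(1 / (1 - y)) powr \<sigma> * v z \<le> \<epsilon>" by (simp add: mult.assoc[symmetric])
        then have "v z \<le> \<epsilon> * (1 - y) powr \<sigma>" using y by (simp add: powr_divide field_simps)
        also have "\<dots> \<le> \<epsilon> * (1 - y\<^sup>2) powr \<sigma>"
        proof (intro mult_left_mono powr_mono2)
          have "y * y \<le> y * 1" using y by (intro mult_left_mono) auto
          then show "1 - y \<le> 1 - y\<^sup>2" by (simp add: power2_eq_square)
        qed (use y \<sigma> \<epsilon> in auto)
        finally show ?thesis by (simp add: y_def)
      qed
      then show "\<exists>\<rho><1. \<forall>z\<in>S. \<rho> < x z \<longrightarrow> v z \<le> \<epsilon> * (1 - (x z)\<^sup>2) powr \<sigma>"
        by (intro exI[of _ "max (1 / 2) (1 - 1 / (real n + 1))"]) (auto simp: field_simps)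
    qed
  next
    assume R: ?R
    show ?L
      unfolding limsup_ennreal_eq_0_iff
    proof (intro allI impI)
      fix e :: real assume e: "0 < e"
      define K where "K \<tau> = (2 * \<tau>) powr \<tau> * exp 1" for \<tau> :: real
      have K: "0 < K \<tau>" if "0 < \<tau>" for \<tau> using that by (simp add: K_def)
      obtain \<rho>' where \<rho>': "\<rho>' < 1" "\<And>z. z \<in> S \<Longrightarrow> \<rho>' < x z \<Longrightarrow> v z \<le> e / K \<sigma> * (1 - (x z)\<^sup>2) powr \<sigma>"
        using R e K[OF \<sigma>] by (meson divide_pos_pos)
      define \<rho> where "\<rho> = max \<rho>' 0"
      have \<rho>: "0 \<le> \<rho>" "\<rho> < 1" using \<rho>' by (auto simp: \<rho>_def)
      \<comment> \<open>Applying \<open>power_weight_bound\<close> with exponent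
        \<open>\<sigma> + 1\<close> leaves a spare factor \<open>1 / j\<close>; from
        \<open>j >= c / e\<close> on it outweighs the constant.\<close>
      define c where "c = \<bar>M\<bar> * (K (\<sigma> + 1) / (1 - \<rho>\<^sup>2) powr (\<sigma> + 1))"
      have "0 < 1 - \<rho>\<^sup>2" using \<rho> by (simp add: power_less_one_iff abs_square_less_1)
      then have r0: "0 < (1 - \<rho>\<^sup>2) powr (\<sigma> + 1)" by simp
      have bd: "real j powr \<sigma> * (v z * x z ^ (j - 1)) \<le> e"
        if z: "z \<in> S" and j: "1 \<le> j" "c / e \<le> real j" for z j
      proof (cases "\<rho> < x z")
        case True
        have "real j powr \<sigma> * (v z * x z ^ (j - 1)) \<le> real j powr \<sigma> * ((e / K \<sigma> * (1 - (x z)\<^sup>2) powr \<sigma>) * x z ^ (j - 1))"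
          using \<rho>'(2)[OF z] True x(1)[OF z] by (intro mult_left_mono mult_right_mono) (auto simp: \<rho>_def)
        also have "\<dots> = e / K \<sigma> * (real j powr \<sigma> * x z ^ (j - 1) * (1 - (x z)\<^sup>2) powr \<sigma>)"
          by simp
        also have "\<dots> \<le> e / K \<sigma> * K \<sigma>"
          unfolding K_def[of \<sigma>] using power_weight_bound[OF x(1)[OF z] x(2)[OF z] \<sigma> j(1)] e
          by (intro mult_left_mono) auto
        also have "\<dots> = e" using K[OF \<sigma>] by simp
        finally show ?thesis .
      next
        case False
        have "real j powr (\<sigma> + 1) * \<rho> ^ (j - 1) * (1 - \<rho>\<^sup>2) powr (\<sigma> + 1) \<le> K (\<sigma> + 1)"
          unfolding K_def using \<sigma> by (intro power_weight_bound \<rho> j) auto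
        then have "real j powr (\<sigma> + 1) * \<rho> ^ (j - 1) \<le> K (\<sigma> + 1) / (1 - \<rho>\<^sup>2) powr (\<sigma> + 1)"
          using r0 by (simp add: pos_le_divide_eq)
        then have "\<bar>M\<bar> * (real j powr (\<sigma> + 1) * \<rho> ^ (j - 1)) \<le> c"
          unfolding c_def by (intro mult_left_mono) auto
        also have "c \<le> real j * e" using j e by (simp add: pos_divide_le_eq)
        also have "real j powr (\<sigma> + 1) = real j * real j powr \<sigma>" using j by (simp add: powr_add)
        finally have "real j * (real j powr \<sigma> * (\<bar>M\<bar> * \<rho> ^ (j - 1))) \<le> real j * e" by (simp add: mult_ac)
        then have le: "real j powr \<sigma> * (\<bar>M\<bar> * \<rho> ^ (j - 1)) \<le> e" using j by simp
        have "real j powr \<sigma> * (v z * x z ^ (j - 1)) \<le> real j powr \<sigma> * (\<bar>M\<bar> * \<rho> ^ (j - 1))"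
          using False v(1,2)[OF z] x(1)[OF z] by (intro mult_left_mono mult_mono power_mono) auto
        with le show ?thesis by linarith
      qed
      have "eventually (\<lambda>j. 1 \<le> j \<and> c / e \<le> real j) sequentially"
        by (intro eventually_conj eventually_ge_at_top) (use eventually_ge_at_top[of "nat \<lceil>c / e\<rceil>"] in \<open>auto elim!: eventually_mono\<close>)
      then show "eventually (\<lambda>j. ennreal (real j powr \<sigma>) * (SUP z\<in>S. ennreal (v z * x z ^ (j - 1))) \<le> ennreal e) sequentially"
        unfolding le_iff[OF e] by eventually_elim (use bd in blast)
    qed
  qed
qed


subsection \<open>Compactness and its characterisation\<close>

interpretation bloch: Metric_space bloch bloch_dist
  by (rule Metric_space_bloch)

lemma bloch_norm_ge:
  assumes f: "f \<in> bloch"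
  shows "cmod (f 0) \<le> bloch_norm f"
    and "z \<in> unit_disk \<Longrightarrow> (1 - (cmod z)\<^sup>2) * cmod (deriv f z) \<le> bloch_norm f"
proof -
  have eq: "bloch_enorm f = ennreal (bloch_norm f)"
    using f by (simp add: bloch_def bloch_norm_def)
  have "ennreal (cmod (f 0)) \<le> bloch_enorm f"
    by (simp add: bloch_enorm_def)
  then show "cmod (f 0) \<le> bloch_norm f"
    unfolding eq by (simp add: bloch_norm_def)
  assume "z \<in> unit_disk"
  then have "ennreal ((1 - (cmod z)\<^sup>2) * cmod (deriv f z)) \<le> bloch_enorm f"
    unfolding bloch_enorm_def by (intro add_increasing SUP_upper) auto
  then show "(1 - (cmod z)\<^sup>2) * cmod (deriv f z) \<le> bloch_norm f"
    unfolding eq by (simp add: bloch_norm_def)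
qed

text \<open>Convergence in the Bloch distance thus controls the value at 0 and every derivative,
  which is what identifies the limits of subsequences below.\<close>

lemma bloch_dist_ge:
  assumes f: "f \<in> bloch" and g: "g \<in> bloch"
  shows "cmod (f 0 - g 0) \<le> bloch_dist f g"
    and "z \<in> unit_disk \<Longrightarrow> (1 - (cmod z)\<^sup>2) * cmod (deriv f z - deriv g z) \<le> bloch_dist f g"
proof -
  note ge = bloch_norm_ge[OF bloch_diff[OF f g]]
  show "cmod (f 0 - g 0) \<le> bloch_dist f g"
    using ge(1) by (simp add: bloch_dist_def)
  assume z: "z \<in> unit_disk"
  have "deriv (\<lambda>z. f z - g z) z = deriv f z - deriv g z"
    using f g hol_disk_differentiable[OF _ z] by (simp add: bloch_def)
  then show "(1 - (cmod z)\<^sup>2) * cmod (deriv f z - deriv g z) \<le> bloch_dist f g"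
    using ge(2)[OF z] by (simp add: bloch_dist_def)
qed

section \<open>Compactness in terms of sequences\<close>

lemma compact_bergman_blochD:
  assumes T: "compact_bergman_bloch p \<alpha> T" and f: "\<And>n::nat. f n \<in> bergman p \<alpha>" "\<And>n. bergman_norm p \<alpha> (f n) \<le> C"
  obtains g r where "g \<in> bloch" "strict_mono (r :: nat \<Rightarrow> nat)" "(\<lambda>n. bloch_dist (T (f (r n))) g) \<longlonglongrightarrow> 0"
proof -
  have TB: "T ` bergman p \<alpha> \<subseteq> bloch" using T by (simp add: compact_bergman_bloch_def)
  define K where "K = bloch.mtopology closure_of (T ` range f)"
  have "range f \<subseteq> bergman p \<alpha> \<and> (\<exists>C. \<forall>h\<in>range f. bergman_norm p \<alpha> h \<le> C)"
    using f by blast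
  then have "compactin bloch.mtopology K"
    using T unfolding compact_bergman_bloch_def K_def by blast
  moreover have "range (\<lambda>n. T (f n)) \<subseteq> K"
    unfolding K_def using closure_of_subset[of "T ` range f" bloch.mtopology] TB f by auto
  ultimately obtain g r where "strict_mono r" "limitin bloch.mtopology ((\<lambda>n. T (f n)) \<circ> r) g sequentially"
    unfolding bloch.compactin_sequentially by metis
  then show thesis
    by (intro that[of g r]) (auto simp: bloch.limitin_metric_dist_null)
qed

text \<open>The sequences to be treated lie in the closure of the image, not in the image itself.
  Each term is replaced by an image point at distance below \<open>1 / (n + 1)\<close>, and a limit
  of the replacements is also a limit of the given sequence.\<close>

lemma compact_bergman_blochI:
  assumes TB: "T ` bergman p \<alpha> \<subseteq> bloch"
    and *: "\<And>f C. (\<And>n::nat. f n \<in> bergman p \<alpha>) \<Longrightarrow> (\<And>n. bergman_norm p \<alpha> (f n) \<le> C) \<Longrightarrow>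
      \<exists>g r. g \<in> bloch \<and> strict_mono (r :: nat \<Rightarrow> nat) \<and> (\<lambda>n. bloch_dist (T (f (r n))) g) \<longlonglongrightarrow> 0"
  shows "compact_bergman_bloch p \<alpha> T"
  unfolding compact_bergman_bloch_def
proof (intro conjI TB allI impI)
  fix S assume S: "S \<subseteq> bergman p \<alpha>" "\<exists>C. \<forall>f\<in>S. bergman_norm p \<alpha> f \<le> C"
  then obtain C where C: "\<And>f. f \<in> S \<Longrightarrow> bergman_norm p \<alpha> f \<le> C" by blast
  define K where "K = bloch.mtopology closure_of (T ` S)"
  have K: "h \<in> K \<longleftrightarrow> h \<in> bloch \<and> (\<forall>e>0. \<exists>f\<in>S. T f \<in> bloch \<and> bloch_dist h (T f) < e)" for h
    unfolding K_def bloch.metric_closure_of by auto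
  have "\<exists>l r. l \<in> K \<and> strict_mono (r :: nat \<Rightarrow> nat) \<and> limitin bloch.mtopology (\<sigma> \<circ> r) l sequentially"
    if \<sigma>: "range \<sigma> \<subseteq> K" for \<sigma> :: "nat \<Rightarrow> _"
  proof -
    have \<sigma>b: "\<sigma> n \<in> bloch" for n using \<sigma> K by blast
    have "\<forall>n. \<exists>f. f \<in> S \<and> bloch_dist (\<sigma> n) (T f) < 1 / real (Suc n)"
      using \<sigma> K by (metis of_nat_0_less_iff range_subsetD zero_less_Suc zero_less_divide_1_iff)
    then obtain f where f: "\<And>n. f n \<in> S" "\<And>n. bloch_dist (\<sigma> n) (T (f n)) < 1 / real (Suc n)"
      by metis
    have fb: "f n \<in> bergman p \<alpha>" "T (f n) \<in> bloch" for n using f(1) S(1) TB by blast+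
    obtain g r where g: "g \<in> bloch" "strict_mono r" "(\<lambda>n. bloch_dist (T (f (r n))) g) \<longlonglongrightarrow> 0"
      using *[of f C] fb(1) f(1) C by blast
    have "(\<lambda>n. 1 / real (Suc n)) \<longlonglongrightarrow> 0"
      using LIMSEQ_inverse_real_of_nat by (simp add: inverse_eq_divide)
    from tendsto_add[OF LIMSEQ_subseq_LIMSEQ[OF this g(2)] g(3)]
    have lim0: "(\<lambda>n. 1 / real (Suc (r n)) + bloch_dist (T (f (r n))) g) \<longlonglongrightarrow> 0" by (simp add: o_def)
    have "bloch_dist (\<sigma> (r n)) g \<le> 1 / real (Suc (r n)) + bloch_dist (T (f (r n))) g" for n
      using bloch.triangle[OF \<sigma>b fb(2) g(1), of "r n" "r n"] f(2)[of "r n"] by linarith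
    then have "(\<lambda>n. bloch_dist (\<sigma> (r n)) g) \<longlonglongrightarrow> 0"
      by (intro Lim_null_comparison[OF _ lim0] always_eventually) simp
    then have lim: "limitin bloch.mtopology (\<sigma> \<circ> r) g sequentially"
      unfolding bloch.limitin_metric_dist_null using g \<sigma>b by (simp add: o_def)
    have "\<exists>h\<in>S. T h \<in> bloch \<and> bloch_dist g (T h) < e" if "0 < e" for e
    proof -
      have "eventually (\<lambda>n. bloch_dist (T (f (r n))) g < e) sequentially"
        using order_tendstoD(2)[OF g(3) that] .
      then obtain n where "bloch_dist (T (f (r n))) g < e" by (meson eventually_sequentially order_refl)
      then show ?thesis using f(1) fb(2) bloch.commute by metis
    qed
    then have "g \<in> K" using K g(1) by blast
    with g lim show ?thesis by blast
  qed
  moreover have "K \<subseteq> bloch" using K by blast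
  ultimately show "compactin bloch.mtopology (bloch.mtopology closure_of T ` S)"
    unfolding bloch.compactin_sequentially K_def[symmetric] by blast
qed

text \<open>The expression under \<open>cmod\<close> is the derivative at \<open>z\<close> of the
  image of the test function with parameter \<open>\<phi> z\<close>. If it stayed large along points
  with \<open>|\<phi>|\<close> tending to 1, the images would keep a positive Bloch distance from 0,
  although 0 is the only possible limit of a convergent subsequence.\<close>

lemma compact_imp_test_fun_vanishing:
  assumes p: "1 \<le> p" and \<alpha>: "-1 < \<alpha>" and u: "u holomorphic_on unit_disk"
    and \<phi>: "\<phi> holomorphic_on unit_disk" "\<phi> ` unit_disk \<subseteq> unit_disk"
    and cpt: "compact_bergman_bloch p \<alpha> (weighted_comp u \<phi>)"
    and s: "s = (2 + \<alpha>) / p" and N: "2 * s \<le> real N" and \<epsilon>: "0 < \<epsilon>"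
  shows "\<exists>\<rho><1. \<forall>z\<in>unit_disk. \<rho> < cmod (\<phi> z) \<longrightarrow>
    (1 - (cmod z)\<^sup>2) * cmod (deriv u z * test_fun N s A B (\<phi> z) (\<phi> z) +
      u z * deriv \<phi> z * deriv (test_fun N s A B (\<phi> z)) (\<phi> z)) \<le> \<epsilon>"
proof (rule ccontr)
  define T where "T = weighted_comp u \<phi>"
  define F where "F = test_fun N s A B"
  assume "\<not> ?thesis"
  then have neg: "\<forall>\<rho><1. \<exists>z\<in>unit_disk. \<rho> < cmod (\<phi> z) \<and> \<epsilon> < (1 - (cmod z)\<^sup>2) * cmod (deriv u z * F (\<phi> z) (\<phi> z) +
      u z * deriv \<phi> z * deriv (F (\<phi> z)) (\<phi> z))"
    unfolding F_def by (simp add: not_le)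
  have "\<forall>n::nat. \<exists>z\<in>unit_disk. 1 - 1 / real (Suc n) < cmod (\<phi> z) \<and> \<epsilon> < (1 - (cmod z)\<^sup>2) * cmod (deriv u z * F (\<phi> z) (\<phi> z) +
      u z * deriv \<phi> z * deriv (F (\<phi> z)) (\<phi> z))"
    by (intro allI neg[rule_format]) simp
  then obtain z where z: "\<And>n. z n \<in> unit_disk" "\<And>n. 1 - 1 / real (Suc n) < cmod (\<phi> (z n))"
    and gt: "\<And>n. \<epsilon> < (1 - (cmod (z n))\<^sup>2) * cmod (deriv u (z n) * F (\<phi> (z n)) (\<phi> (z n)) +
      u (z n) * deriv \<phi> (z n) * deriv (F (\<phi> (z n))) (\<phi> (z n)))"
    by metis
  define a where "a n = \<phi> (z n)" for n
  have a: "a n \<in> unit_disk" for n using z(1) \<phi>(2) unfolding a_def by blast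
  obtain M where M: "\<And>a. a \<in> unit_disk \<Longrightarrow> F a \<in> bergman p \<alpha>" "\<And>a. a \<in> unit_disk \<Longrightarrow> bergman_norm p \<alpha> (F a) \<le> M"
    unfolding F_def using test_fun_bergman[OF p \<alpha> s N] by metis
  obtain g r where g: "g \<in> bloch" "strict_mono r" "(\<lambda>n. bloch_dist (T (F (a (r n)))) g) \<longlonglongrightarrow> 0"
    using compact_bergman_blochD[OF cpt, of "\<lambda>n. F (a n)" M] M a unfolding T_def by metis
  have TF: "T (F (a n)) \<in> bloch" for n
    using cpt M(1)[OF a] unfolding compact_bergman_bloch_def T_def by blast
  have dT: "deriv (T (F (a n))) w = deriv u w * F (a n) (\<phi> w) + u w * deriv \<phi> w * deriv (F (a n)) (\<phi> w)"
    if "w \<in> unit_disk" for w n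
    unfolding T_def F_def by (intro DERIV_imp_deriv weighted_comp_has_field_derivative u \<phi> test_fun_hol_disk a that)
  have s0: "0 < s" using p \<alpha> by (simp add: s)
  have "(\<lambda>n. 1 - (cmod (a n))\<^sup>2) \<longlonglongrightarrow> 0"
  proof (rule tendsto_sandwich[of "\<lambda>_. 0" _ _ "\<lambda>n. 2 * (1 / real (Suc n))"])
    show "\<forall>\<^sub>F n in sequentially. 0 \<le> 1 - (cmod (a n))\<^sup>2"
      using one_minus_cmod_sq(3)[OF a] by (simp add: less_imp_le)
    have "1 - (cmod (a n))\<^sup>2 \<le> 2 * (1 / real (Suc n))" for n
    proof -
      have "1 - cmod (a n) \<le> 1 / real (Suc n)" using z(2)[of n] unfolding a_def by argo
      then have "2 * (1 - cmod (a n)) \<le> 2 * (1 / real (Suc n))" by (rule mult_left_mono) simp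
      with one_minus_cmod_sq(2)[OF a[of n]] show ?thesis by (rule order_trans)
    qed
    then show "\<forall>\<^sub>F n in sequentially. 1 - (cmod (a n))\<^sup>2 \<le> 2 * (1 / real (Suc n))" by simp
    show "(\<lambda>n. 2 * (1 / real (Suc n))) \<longlonglongrightarrow> 0"
      using tendsto_mult[OF tendsto_const[of 2] LIMSEQ_inverse_real_of_nat] by (simp add: inverse_eq_divide)
  qed simp
  then have "(\<lambda>n. 1 - (cmod (a (r n)))\<^sup>2) \<longlonglongrightarrow> 0"
    using LIMSEQ_subseq_LIMSEQ[OF _ g(2)] by (force simp: o_def)
  \<comment> \<open>\<open>2 * s <= N\<close> and \<open>s > 0\<close> make the exponent
    \<open>N - s\<close> positive.\<close>
  then have lim: "(\<lambda>n. C * (1 - (cmod (a (r n)))\<^sup>2) powr (real N - s)) \<longlonglongrightarrow> 0" for C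
    using s0 N one_minus_cmod_sq(3)[OF a]
    by (intro tendsto_mult_right_zero tendsto_zero_powrI[OF _ tendsto_const]) (auto simp: less_imp_le)
  have F0: "(\<lambda>n. F (a (r n)) w) \<longlonglongrightarrow> 0" "(\<lambda>n. deriv (F (a (r n))) w) \<longlonglongrightarrow> 0" if w: "w \<in> unit_disk" for w
  proof -
    obtain C where C: "\<And>a. a \<in> unit_disk \<Longrightarrow> cmod (F a w) \<le> C * (1 - (cmod a)\<^sup>2) powr (real N - s)"
      "\<And>a. a \<in> unit_disk \<Longrightarrow> cmod (deriv (F a) w) \<le> C * (1 - (cmod a)\<^sup>2) powr (real N - s)"
      unfolding F_def using test_fun_small[OF w] by metis
    show "(\<lambda>n. F (a (r n)) w) \<longlonglongrightarrow> 0"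
      by (rule Lim_null_comparison[OF _ lim[of C]]) (intro always_eventually allI C a)
    show "(\<lambda>n. deriv (F (a (r n))) w) \<longlonglongrightarrow> 0"
      by (rule Lim_null_comparison[OF _ lim[of C]]) (intro always_eventually allI C a)
  qed
  \<comment> \<open>A quantity controlled by the Bloch distance converges to its counterpart for
    \<open>g\<close>; as it also tends to 0, that counterpart is 0. This is used for the value at 0
    and for the derivative at each point.\<close>
  have uniq: "x = 0" if "\<And>n. cmod (y n - x) \<le> c * bloch_dist (T (F (a (r n)))) g" "y \<longlonglongrightarrow> 0" for x y c
  proof -
    have "(\<lambda>n. y n - x) \<longlonglongrightarrow> 0"
      by (rule Lim_null_comparison[OF _ tendsto_mult_right_zero[OF g(3), of c]]) (simp add: that)
    then have "y \<longlonglongrightarrow> x" by (simp add: LIM_zero_iff)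
    then show "x = 0" using that(2) LIMSEQ_unique by blast
  qed
  have "g 0 = 0"
  proof (rule uniq[of "\<lambda>n. T (F (a (r n))) 0" _ 1])
    have "\<phi> 0 \<in> unit_disk" using \<phi>(2) by (simp add: image_subset_iff)
    from tendsto_mult_right_zero[OF F0(1)[OF this], of "u 0"]
    show "(\<lambda>n. T (F (a (r n))) 0) \<longlonglongrightarrow> 0" by (simp add: T_def weighted_comp_def)
  qed (use bloch_dist_ge(1)[OF TF g(1)] in simp)
  moreover have "deriv g w = 0" if w: "w \<in> unit_disk" for w
  proof (rule uniq[of "\<lambda>n. deriv (T (F (a (r n)))) w" _ "1 / (1 - (cmod w)\<^sup>2)"])
    have w': "\<phi> w \<in> unit_disk" using \<phi>(2) w by blast
    show "(\<lambda>n. deriv (T (F (a (r n)))) w) \<longlonglongrightarrow> 0"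
      unfolding dT[OF w] using F0[OF w'] by (intro tendsto_add_zero tendsto_mult_right_zero)
    show "cmod (deriv (T (F (a (r n)))) w - deriv g w) \<le> 1 / (1 - (cmod w)\<^sup>2) * bloch_dist (T (F (a (r n)))) g" for n
      using bloch_dist_ge(2)[OF TF g(1) w, of "r n"] one_minus_cmod_sq(3)[OF w] by (simp add: field_simps)
  qed
  ultimately have "bloch_enorm g = 0" by (simp add: bloch_enorm_def)
  then have "g = (\<lambda>_. 0)" using g(1) by (intro bloch_enorm_eq_0) (auto simp: bloch_def)
  moreover have "\<epsilon> \<le> bloch_dist (T (F (a (r n)))) g" for n
  proof -
    have "\<epsilon> < (1 - (cmod (z (r n)))\<^sup>2) * cmod (deriv (T (F (a (r n)))) (z (r n)))"
      using gt[of "r n"] by (simp only: dT[OF z(1)]) (simp only: a_def)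
    also have "\<dots> \<le> bloch_dist (T (F (a (r n)))) g"
      using bloch_dist_ge(2)[OF TF g(1) z(1), of "r n" "r n"] by (simp add: \<open>g = (\<lambda>_. 0)\<close>)
    finally show ?thesis by simp
  qed
  ultimately have "\<epsilon> \<le> 0"
    using g(3) by (intro LIMSEQ_le_const[OF g(3)]) auto
  with \<epsilon> show False by simp
qed

text \<open>Split the disk at \<open>|\<phi> z| = \<rho>\<close>. Inside, \<open>d n\<close> and its
  derivative are uniformly small and the weights are bounded. Outside, the growth bounds of
  \<open>d n\<close> do not improve with \<open>n\<close>, but there the weights are small exactly
  relative to them.\<close>

lemma weighted_comp_tendsto_0:
  assumes u: "u holomorphic_on unit_disk"
    and \<phi>: "\<phi> holomorphic_on unit_disk" "\<phi> ` unit_disk \<subseteq> unit_disk"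
    and d: "\<And>n. d n \<in> hol_disk" and L: "0 \<le> L" and s: "0 \<le> s"
    and bd: "\<And>n w. w \<in> unit_disk \<Longrightarrow> cmod (d n w) \<le> L * (1 - (cmod w)\<^sup>2) powr (- s)"
    and unif: "\<And>\<rho>. \<rho> < 1 \<Longrightarrow> uniform_limit (cball 0 \<rho>) d (\<lambda>_. 0) sequentially"
    and M1: "\<And>z. z \<in> unit_disk \<Longrightarrow> (1 - (cmod z)\<^sup>2) * cmod (deriv u z) \<le> M"
    and M2: "\<And>z. z \<in> unit_disk \<Longrightarrow> (1 - (cmod z)\<^sup>2) * cmod (u z * deriv \<phi> z) \<le> M"
    and c1: "\<forall>\<epsilon>>0. \<exists>\<rho><1. \<forall>z\<in>unit_disk. \<rho> < cmod (\<phi> z) \<longrightarrow>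
      (1 - (cmod z)\<^sup>2) * cmod (deriv u z) \<le> \<epsilon> * (1 - (cmod (\<phi> z))\<^sup>2) powr s"
    and c2: "\<forall>\<epsilon>>0. \<exists>\<rho><1. \<forall>z\<in>unit_disk. \<rho> < cmod (\<phi> z) \<longrightarrow>
      (1 - (cmod z)\<^sup>2) * cmod (u z * deriv \<phi> z) \<le> \<epsilon> * (1 - (cmod (\<phi> z))\<^sup>2) powr (s + 1)"
    and e: "0 < e"
  shows "eventually (\<lambda>n. bloch_enorm (weighted_comp u \<phi> (d n)) \<le> ennreal e) sequentially"
proof -
  define L' where "L' = 4 powr (s + 1) * L"
  have L': "0 \<le> L'" using L by (simp add: L'_def)
  \<comment> \<open>In the outer region the two terms add up to at most
    \<open>\<epsilon> * (L + L')\<close>, which has to stay below \<open>e / 2\<close>.\<close>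
  define \<epsilon> where "\<epsilon> = e / (2 * (L + L' + 1))"
  have \<epsilon>: "0 < \<epsilon>" using e L L' by (simp add: \<epsilon>_def)
  obtain \<rho>1 where \<rho>1: "\<rho>1 < 1" "\<And>z. z \<in> unit_disk \<Longrightarrow> \<rho>1 < cmod (\<phi> z) \<Longrightarrow>
      (1 - (cmod z)\<^sup>2) * cmod (deriv u z) \<le> \<epsilon> * (1 - (cmod (\<phi> z))\<^sup>2) powr s"
    using c1 \<epsilon> by blast
  obtain \<rho>2 where \<rho>2: "\<rho>2 < 1" "\<And>z. z \<in> unit_disk \<Longrightarrow> \<rho>2 < cmod (\<phi> z) \<Longrightarrow>
      (1 - (cmod z)\<^sup>2) * cmod (u z * deriv \<phi> z) \<le> \<epsilon> * (1 - (cmod (\<phi> z))\<^sup>2) powr (s + 1)"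
    using c2 \<epsilon> by blast
  have \<phi>D: "\<phi> z \<in> unit_disk" if "z \<in> unit_disk" for z using \<phi>(2) that by blast
  \<comment> \<open>Including \<open>|\<phi> 0|\<close> puts the point needed for the value at 0
    into the inner region.\<close>
  define \<rho> where "\<rho> = max (cmod (\<phi> 0)) (max \<rho>1 \<rho>2)"
  have \<rho>: "\<rho> < 1" "cmod (\<phi> 0) \<le> \<rho>" "\<rho>1 \<le> \<rho>" "\<rho>2 \<le> \<rho>" using \<rho>1 \<rho>2 \<phi>D[of 0] by (auto simp: \<rho>_def)
  \<comment> \<open>A margin of width \<open>h\<close> around the inner region, still inside the
    disk: smallness of \<open>d n\<close> on the larger disk gives smallness of the derivative on
    the inner one, at the cost of the factor \<open>1 / h\<close>.\<close>
  define h where "h = (1 - \<rho>) / 2"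
  have h: "0 < h" using \<rho> by (simp add: h_def)
  have M0: "0 \<le> M" using M1[of 0] by (simp add: order_trans[rotated])
  \<comment> \<open>All factors that multiply the sup bound \<eta> of \<open>d n\<close>:
    \<open>M\<close> for the value, \<open>M / h\<close> for the derivative, and
    \<open>|u 0|\<close> for the evaluation at 0.\<close>
  define c where "c = M + M / h + cmod (u 0) + 1"
  have c: "0 < c" "M + M / h \<le> c" "cmod (u 0) \<le> c" using M0 h by (auto simp: c_def add_nonneg_pos)
  define \<eta> where "\<eta> = e / (2 * c)"
  have \<eta>: "0 < \<eta>" using e c by (simp add: \<eta>_def)
  have "eventually (\<lambda>n. \<forall>w\<in>cball 0 (\<rho> + h). dist (d n w) 0 < \<eta>) sequentially"
    using \<rho> by (intro uniform_limitD unif \<eta>) (simp add: h_def field_simps)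
  then show ?thesis
  proof eventually_elim
    case (elim n)
    then have small: "cmod (d n w) \<le> \<eta>" if "cmod w \<le> \<rho> + h" for w using that by (simp add: less_imp_le)
    have small': "cmod (deriv (d n) w) \<le> \<eta> / h" if w: "cmod w \<le> \<rho>" for w
    proof -
      have sub: "cmod z \<le> \<rho> + h" if "z \<in> cball w h" for z
        using that w norm_triangle_sub[of z w] by (simp add: dist_norm norm_minus_commute)
      moreover have "\<rho> + h < 1" using \<rho>(1) by (simp add: h_def field_simps)
      ultimately have sub': "cball w h \<subseteq> unit_disk" by (meson mem_ball_0 order_le_less_trans subsetI)
      have hol: "d n holomorphic_on unit_disk" using d by (simp add: hol_disk_def)
      have "cmod ((deriv ^^ 1) (d n) w) \<le> fact 1 * \<eta> / h ^ 1"
      proof (rule Cauchy_inequality[OF _ _ h])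
        show "d n holomorphic_on ball w h"
          using hol sub' by (meson ball_subset_cball holomorphic_on_subset)
        show "continuous_on (cball w h) (d n)"
          using hol sub' by (meson holomorphic_on_imp_continuous_on holomorphic_on_subset)
        fix x assume "cmod (w - x) = h"
        then show "cmod (d n x) \<le> \<eta>" by (intro small sub) (simp add: dist_norm)
      qed
      then show ?thesis by simp
    qed
    have "cmod (u 0) * cmod (d n (\<phi> 0)) \<le> c * \<eta>"
      using c \<rho> h by (intro mult_mono small) auto
    then have 0: "cmod (weighted_comp u \<phi> (d n) 0) \<le> e / 2"
      using c by (simp add: weighted_comp_def norm_mult \<eta>_def)
    have "(1 - (cmod z)\<^sup>2) * cmod (deriv (weighted_comp u \<phi> (d n)) z) \<le> e / 2" if z: "z \<in> unit_disk" for z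
    proof -
      define v1 where "v1 = (1 - (cmod z)\<^sup>2) * cmod (deriv u z)"
      define v2 where "v2 = (1 - (cmod z)\<^sup>2) * cmod (u z * deriv \<phi> z)"
      define y where "y = 1 - (cmod (\<phi> z))\<^sup>2"
      have y: "0 < y" using one_minus_cmod_sq(3)[OF \<phi>D[OF z]] by (simp add: y_def)
      have v0: "0 \<le> v1" "0 \<le> v2"
        using one_minus_cmod_sq(3)[OF z] by (auto simp: v1_def v2_def)
      have "cmod (deriv (weighted_comp u \<phi> (d n)) z) \<le>
          cmod (deriv u z) * cmod (d n (\<phi> z)) + cmod (u z * deriv \<phi> z) * cmod (deriv (d n) (\<phi> z))"
        unfolding DERIV_imp_deriv[OF weighted_comp_has_field_derivative[OF u \<phi> d z]]
        by (intro order_trans[OF norm_triangle_ineq]) (simp add: norm_mult)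
      from mult_left_mono[OF this, of "1 - (cmod z)\<^sup>2"] one_minus_cmod_sq(3)[OF z]
      have "(1 - (cmod z)\<^sup>2) * cmod (deriv (weighted_comp u \<phi> (d n)) z) \<le>
          v1 * cmod (d n (\<phi> z)) + v2 * cmod (deriv (d n) (\<phi> z))"
        by (simp add: v1_def v2_def distrib_left mult.assoc)
      also have "\<dots> \<le> e / 2"
      proof (cases "cmod (\<phi> z) \<le> \<rho>")
        case True
        have "v1 * cmod (d n (\<phi> z)) + v2 * cmod (deriv (d n) (\<phi> z)) \<le> M * \<eta> + M * (\<eta> / h)"
          using True M1[OF z] M2[OF z] M0 v0 h \<eta>
          by (intro add_mono mult_mono small small') (auto simp: v1_def v2_def)
        also have "\<dots> = (M + M / h) * \<eta>" by (simp add: algebra_simps)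
        also have "\<dots> \<le> c * \<eta>" using c \<eta> by (intro mult_right_mono) auto
        also have "\<dots> = e / 2" using c by (simp add: \<eta>_def)
        finally show ?thesis .
      next
        case False
        have hol: "d n holomorphic_on unit_disk" using d by (simp add: hol_disk_def)
        have "cmod (deriv (d n) (\<phi> z)) \<le> L' * y powr (- (s + 1))"
          unfolding L'_def y_def by (rule deriv_pointwise_bound[OF hol s bd \<phi>D[OF z] L])
        then have "v1 * cmod (d n (\<phi> z)) + v2 * cmod (deriv (d n) (\<phi> z)) \<le>
            (\<epsilon> * y powr s) * (L * y powr (- s)) + (\<epsilon> * y powr (s + 1)) * (L' * y powr (- (s + 1)))"
          using \<rho>1(2)[OF z] \<rho>2(2)[OF z] False \<rho> bd[OF \<phi>D[OF z]] v0 \<epsilon>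
          by (intro add_mono mult_mono) (auto simp: v1_def v2_def y_def)
        also have "\<dots> = \<epsilon> * L * (y powr s * y powr (- s)) + \<epsilon> * L' * (y powr (s + 1) * y powr (- (s + 1)))"
          by (simp only: mult_ac)
        also have "\<dots> = \<epsilon> * (L + L')"
          using y by (simp add: powr_add[symmetric] distrib_left)
        also have "\<dots> \<le> \<epsilon> * (L + L' + 1)" using \<epsilon> by (intro mult_left_mono) auto
        also have "\<dots> = e / 2" using L L' by (simp add: \<epsilon>_def field_simps)
        finally show ?thesis .
      qed
      finally show ?thesis .
    qed
    then have "bloch_enorm (weighted_comp u \<phi> (d n)) \<le> ennreal (e / 2) + ennreal (e / 2)"
      unfolding bloch_enorm_def by (intro add_mono SUP_least ennreal_leI 0) auto
    also have "\<dots> = ennreal e" using e by (simp flip: ennreal_plus)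
    finally show ?case .
  qed
qed


text \<open>A bounded sequence is locally bounded by the growth estimate, so Montel yields a locally
  uniform limit. Only the growth bound is passed on to that limit, and it suffices for applying the
  previous lemma to the differences.\<close>

lemma vanishing_imp_compact:
  assumes p: "1 \<le> p" and \<alpha>: "-1 < \<alpha>" and u: "u holomorphic_on unit_disk"
    and \<phi>: "\<phi> holomorphic_on unit_disk" "\<phi> ` unit_disk \<subseteq> unit_disk"
    and TB: "weighted_comp u \<phi> ` bergman p \<alpha> \<subseteq> bloch" and s: "s = (2 + \<alpha>) / p"
    and M1: "\<And>z. z \<in> unit_disk \<Longrightarrow> (1 - (cmod z)\<^sup>2) * cmod (deriv u z) \<le> M"
    and M2: "\<And>z. z \<in> unit_disk \<Longrightarrow> (1 - (cmod z)\<^sup>2) * cmod (u z * deriv \<phi> z) \<le> M"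
    and c1: "\<forall>\<epsilon>>0. \<exists>\<rho><1. \<forall>z\<in>unit_disk. \<rho> < cmod (\<phi> z) \<longrightarrow>
      (1 - (cmod z)\<^sup>2) * cmod (deriv u z) \<le> \<epsilon> * (1 - (cmod (\<phi> z))\<^sup>2) powr s"
    and c2: "\<forall>\<epsilon>>0. \<exists>\<rho><1. \<forall>z\<in>unit_disk. \<rho> < cmod (\<phi> z) \<longrightarrow>
      (1 - (cmod z)\<^sup>2) * cmod (u z * deriv \<phi> z) \<le> \<epsilon> * (1 - (cmod (\<phi> z))\<^sup>2) powr (s + 1)"
  shows "compact_bergman_bloch p \<alpha> (weighted_comp u \<phi>)"
proof (rule compact_bergman_blochI[OF TB])
  fix f :: "nat \<Rightarrow> complex \<Rightarrow> complex" and C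
  assume f: "\<And>n. f n \<in> bergman p \<alpha>" "\<And>n. bergman_norm p \<alpha> (f n) \<le> C"
  define T where "T = weighted_comp u \<phi>"
  have s0: "0 \<le> s" using p \<alpha> by (simp add: s)
  obtain K where K: "0 < K" "\<And>f w. f \<in> bergman p \<alpha> \<Longrightarrow> w \<in> unit_disk \<Longrightarrow>
    cmod (f w) \<le> K * bergman_norm p \<alpha> f * (1 - (cmod w)\<^sup>2) powr (- s)"
    using bergman_pointwise_bound[OF p \<alpha>] unfolding s by metis
  define L where "L = K * C"
  have C: "0 \<le> C" using f(2)[of 0] by (simp add: bergman_norm_def order_trans[rotated])
  have L: "0 \<le> L" using K C by (simp add: L_def)
  have bd: "cmod (f n w) \<le> L * (1 - (cmod w)\<^sup>2) powr (- s)" if "w \<in> unit_disk" for n w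
    unfolding L_def using K(1) f(2)[of n]
    by (intro order_trans[OF K(2)[OF f(1) that]] mult_right_mono mult_left_mono) auto
  have fd: "f n \<in> hol_disk" for n using f(1) by (simp add: bergman_def)
  have hol: "\<And>h. h \<in> range f \<Longrightarrow> h holomorphic_on unit_disk" using fd by (auto simp: hol_disk_def)
  have bdd: "\<exists>B. \<forall>h\<in>range f. \<forall>z\<in>X. cmod (h z) \<le> B" if X: "compact X" "X \<subseteq> unit_disk" for X
  proof -
    have "continuous_on X (\<lambda>w. L * (1 - (cmod w)\<^sup>2) powr (- s))"
      using X(2) one_minus_cmod_sq(3) by (intro continuous_intros) force
    then have "bounded ((\<lambda>w. L * (1 - (cmod w)\<^sup>2) powr (- s)) ` X)"
      using X(1) by (intro compact_imp_bounded compact_continuous_image)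
    then obtain B where B: "\<And>w. w \<in> X \<Longrightarrow> \<bar>L * (1 - (cmod w)\<^sup>2) powr (- s)\<bar> \<le> B"
      by (auto simp: bounded_iff)
    have "cmod (f n z) \<le> B" if "z \<in> X" for n z
      using bd[of z n] B[OF that] X(2) that by (meson abs_ge_self order_trans subsetD)
    then show ?thesis by blast
  qed
  obtain g r where g: "g holomorphic_on unit_disk" "strict_mono (r :: nat \<Rightarrow> nat)"
      "\<And>x. x \<in> unit_disk \<Longrightarrow> ((\<lambda>n. f (r n) x) \<longlongrightarrow> g x) sequentially"
      "\<And>K. compact K \<Longrightarrow> K \<subseteq> unit_disk \<Longrightarrow> uniform_limit K (f \<circ> r) g sequentially"
    by (rule Montel[of unit_disk "range f" f, OF open_ball hol bdd order_refl], assumption+) (rule that, assumption+)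
  define G where "G z = (if z \<in> unit_disk then g z else 0)" for z
  have "G holomorphic_on unit_disk"
    by (rule holomorphic_transform[OF g(1)]) (simp add: G_def)
  then have G: "G \<in> hol_disk" by (simp add: hol_disk_def G_def)
  define d where "d n z = f (r n) z - G z" for n z
  have d: "d n \<in> hol_disk" for n unfolding d_def using fd G by (intro hol_disk_diff)
  have bd': "cmod (d n w) \<le> (2 * L) * (1 - (cmod w)\<^sup>2) powr (- s)" if w: "w \<in> unit_disk" for n w
  proof -
    have "(\<lambda>n. cmod (f (r n) w)) \<longlonglongrightarrow> cmod (G w)"
      using tendsto_norm[OF g(3)[OF w]] w by (simp add: G_def)
    then have "cmod (G w) \<le> L * (1 - (cmod w)\<^sup>2) powr (- s)"
      by (rule LIMSEQ_le_const2) (use bd[OF w] in blast)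
    with bd[OF w, of "r n"] show ?thesis
      unfolding d_def using norm_triangle_ineq4[of "f (r n) w" "G w"] by linarith
  qed
  have unif: "uniform_limit (cball 0 \<rho>) d (\<lambda>_. 0) sequentially" if "\<rho> < 1" for \<rho>
  proof -
    have sub: "cball 0 \<rho> \<subseteq> unit_disk" using that by auto
    show ?thesis
      using g(4)[OF compact_cball sub] sub
      unfolding uniform_limit_iff d_def G_def by (force simp: dist_norm elim!: eventually_mono)
  qed
  have Td: "T (d n) = (\<lambda>z. T (f (r n)) z - T G z)" for n
    by (auto simp: T_def weighted_comp_def d_def algebra_simps)
  have ev: "eventually (\<lambda>n. bloch_enorm (T (d n)) \<le> ennreal e) sequentially" if "0 < e" for e
    unfolding T_def by (rule weighted_comp_tendsto_0[OF u \<phi> d _ s0 bd' unif M1 M2 c1 c2 that]) (use L in auto)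
  \<comment> \<open>\<open>T G\<close> is the difference of \<open>T (f (r n))\<close>, in the Bloch
    space by hypothesis, and \<open>T (d n)\<close>, whose Bloch norm is finite for large
    \<open>n\<close>.\<close>
  have "T G \<in> bloch"
  proof -
    obtain n where n: "bloch_enorm (T (d n)) \<le> ennreal 1"
      using ev[of 1] by (meson eventually_sequentially order_refl zero_less_one)
    have "T (d n) \<in> bloch"
      unfolding bloch_def using weighted_comp_hol_disk[OF u \<phi> d, of n] le_less_trans[OF n ennreal_less_top]
      by (simp add: T_def)
    moreover have "T (f (r n)) \<in> bloch" using TB f(1) unfolding T_def by blast
    ultimately have "(\<lambda>z. T (f (r n)) z - T (d n) z) \<in> bloch" by (intro bloch_diff)
    then show ?thesis by (simp add: Td)
  qed
  moreover have "(\<lambda>n. bloch_dist (T (f (r n))) (T G)) \<longlonglongrightarrow> 0"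
  proof (rule order_tendstoI)
    fix e :: real assume e: "0 < e"
    have "eventually (\<lambda>n. bloch_enorm (T (d n)) \<le> ennreal (e / 2)) sequentially"
      by (rule ev) (use e in simp)
    then show "eventually (\<lambda>n. bloch_dist (T (f (r n))) (T G) < e) sequentially"
    proof eventually_elim
      case (elim n)
      then have "bloch_norm (T (d n)) \<le> e / 2"
        using e unfolding bloch_norm_def by (intro enn2real_leI) auto
      then show ?case using e by (simp add: bloch_dist_def Td)
    qed
  next
    fix e :: real assume "e < 0"
    then show "eventually (\<lambda>n. e < bloch_dist (T (f (r n))) (T G)) sequentially"
      by (intro always_eventually allI less_le_trans[OF _ bloch.nonneg])
  qed
  ultimately show "\<exists>g r. g \<in> bloch \<and> strict_mono r \<and> (\<lambda>n. bloch_dist (weighted_comp u \<phi> (f (r n))) g) \<longlonglongrightarrow> 0"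
    using g(2) unfolding T_def by blast
qed

text \<open>The first choice of coefficients has zero derivative at \<open>\<phi> z\<close> and
  leaves only the term with \<open>u'\<close>; the second has zero value there and leaves only the
  term with \<open>u * \<phi>'\<close>.\<close>

lemma compact_imp_vanishing:
  assumes p: "1 \<le> p" and \<alpha>: "-1 < \<alpha>" and u: "u holomorphic_on unit_disk"
    and \<phi>: "\<phi> holomorphic_on unit_disk" "\<phi> ` unit_disk \<subseteq> unit_disk"
    and cpt: "compact_bergman_bloch p \<alpha> (weighted_comp u \<phi>)"
    and s: "s = (2 + \<alpha>) / p" and \<epsilon>: "0 < \<epsilon>"
  shows "\<exists>\<rho><1. \<forall>z\<in>unit_disk. \<rho> < cmod (\<phi> z) \<longrightarrow>
      (1 - (cmod z)\<^sup>2) * cmod (deriv u z) \<le> \<epsilon> * (1 - (cmod (\<phi> z))\<^sup>2) powr s"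
    and "\<exists>\<rho><1. \<forall>z\<in>unit_disk. \<rho> < cmod (\<phi> z) \<longrightarrow>
      (1 - (cmod z)\<^sup>2) * cmod (u z * deriv \<phi> z) \<le> \<epsilon> * (1 - (cmod (\<phi> z))\<^sup>2) powr (s + 1)"
proof -
  obtain N where N: "2 * s \<le> real N" using real_arch_simple by blast
  have \<phi>D: "\<phi> z \<in> unit_disk" if "z \<in> unit_disk" for z using \<phi>(2) that by blast
  note van = compact_imp_test_fun_vanishing[OF p \<alpha> u \<phi> cpt s N]
  obtain \<rho> where \<rho>: "\<rho> < 1" and le: "\<And>z. z \<in> unit_disk \<Longrightarrow> \<rho> < cmod (\<phi> z) \<Longrightarrow>
    (1 - (cmod z)\<^sup>2) * cmod (deriv u z * test_fun N s (real N + 1) (- real N) (\<phi> z) (\<phi> z) +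
      u z * deriv \<phi> z * deriv (test_fun N s (real N + 1) (- real N) (\<phi> z)) (\<phi> z)) \<le> \<epsilon>"
    using van[OF \<epsilon>, of "real N + 1" "- real N"] by blast
  have "(1 - (cmod z)\<^sup>2) * cmod (deriv u z) \<le> \<epsilon> * (1 - (cmod (\<phi> z))\<^sup>2) powr s"
    if z: "z \<in> unit_disk" "\<rho> < cmod (\<phi> z)" for z
  proof -
    define y where "y = 1 - (cmod (\<phi> z))\<^sup>2"
    have y: "0 < y" using one_minus_cmod_sq(3)[OF \<phi>D[OF z(1)]] by (simp add: y_def)
    have "(1 - (cmod z)\<^sup>2) * cmod (deriv u z) * y powr (- s) \<le> \<epsilon>"
      using le[OF z] unfolding test_fun_at[OF \<phi>D[OF z(1)]] y_def[symmetric]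
      by (simp add: norm_mult algebra_simps)
    then show ?thesis
      unfolding y_def[symmetric] using y by (simp add: powr_minus field_simps)
  qed
  with \<rho> show "\<exists>\<rho><1. \<forall>z\<in>unit_disk. \<rho> < cmod (\<phi> z) \<longrightarrow>
      (1 - (cmod z)\<^sup>2) * cmod (deriv u z) \<le> \<epsilon> * (1 - (cmod (\<phi> z))\<^sup>2) powr s" by blast
  \<comment> \<open>The derivative of the second test function carries a factor
    \<open>cnj (\<phi> z)\<close>. Restricting to \<open>|\<phi> z| > 1/2\<close> makes its loss at
    most a factor 2, compensated by starting from half of \<epsilon>.\<close>
  have "0 < \<epsilon> / 2" using \<epsilon> by simp
  from van[OF this, of "-1" 1] obtain \<rho>' where \<rho>': "\<rho>' < 1" and le': "\<And>z. z \<in> unit_disk \<Longrightarrow> \<rho>' < cmod (\<phi> z) \<Longrightarrow>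
    (1 - (cmod z)\<^sup>2) * cmod (deriv u z * test_fun N s (-1) 1 (\<phi> z) (\<phi> z) +
      u z * deriv \<phi> z * deriv (test_fun N s (-1) 1 (\<phi> z)) (\<phi> z)) \<le> \<epsilon> / 2"
    by blast
  have "(1 - (cmod z)\<^sup>2) * cmod (u z * deriv \<phi> z) \<le> \<epsilon> * (1 - (cmod (\<phi> z))\<^sup>2) powr (s + 1)"
    if z: "z \<in> unit_disk" "max \<rho>' (1 / 2) < cmod (\<phi> z)" for z
  proof -
    define y where "y = 1 - (cmod (\<phi> z))\<^sup>2"
    have y: "0 < y" using one_minus_cmod_sq(3)[OF \<phi>D[OF z(1)]] by (simp add: y_def)
    define V where "V = (1 - (cmod z)\<^sup>2) * cmod (u z * deriv \<phi> z) * y powr (- (s + 1))"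
    have V: "0 \<le> V" using one_minus_cmod_sq(3)[OF z(1)] by (simp add: V_def)
    have "V * cmod (\<phi> z) \<le> \<epsilon> / 2"
      using le'[OF z(1)] z(2) unfolding test_fun_at[OF \<phi>D[OF z(1)]] y_def[symmetric]
      by (simp add: V_def norm_mult mult_ac)
    moreover have "V * (1 / 2) \<le> V * cmod (\<phi> z)" using z(2) V by (intro mult_left_mono) auto
    ultimately have "V \<le> \<epsilon>" by linarith
    then have "V * y powr (s + 1) \<le> \<epsilon> * y powr (s + 1)" by (intro mult_right_mono) auto
    moreover have "y powr (- (s + 1)) * y powr (s + 1) = 1" using y by (simp flip: powr_add)
    ultimately show ?thesis unfolding y_def[symmetric] by (simp add: V_def mult.assoc)
  qed
  with \<rho>' show "\<exists>\<rho><1. \<forall>z\<in>unit_disk. \<rho> < cmod (\<phi> z) \<longrightarrow>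
      (1 - (cmod z)\<^sup>2) * cmod (u z * deriv \<phi> z) \<le> \<epsilon> * (1 - (cmod (\<phi> z))\<^sup>2) powr (s + 1)"
    by (intro exI[of _ "max \<rho>' (1 / 2)"]) auto
qed

text \<open>The function 1 is mapped to \<open>u\<close>, which bounds the first weight. The
  function \<open>z\<close> is mapped to \<open>u * \<phi>\<close>; subtracting
  \<open>u' * \<phi>\<close> from its derivative bounds the second, since
  \<open>|\<phi>| < 1\<close>.\<close>

lemma bounded_weights:
  assumes p: "1 \<le> p" and \<alpha>: "-1 < \<alpha>" and u: "u holomorphic_on unit_disk"
    and \<phi>: "\<phi> holomorphic_on unit_disk" "\<phi> ` unit_disk \<subseteq> unit_disk"
    and TB: "weighted_comp u \<phi> ` bergman p \<alpha> \<subseteq> bloch"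
  obtains M where "\<And>z. z \<in> unit_disk \<Longrightarrow> (1 - (cmod z)\<^sup>2) * cmod (deriv u z) \<le> M"
    and "\<And>z. z \<in> unit_disk \<Longrightarrow> (1 - (cmod z)\<^sup>2) * cmod (u z * deriv \<phi> z) \<le> M"
proof -
  define f0 :: "complex \<Rightarrow> complex" where "f0 z = (if z \<in> unit_disk then 1 else 0)" for z
  define f1 :: "complex \<Rightarrow> complex" where "f1 z = (if z \<in> unit_disk then z else 0)" for z
  have "f0 holomorphic_on unit_disk"
    by (rule holomorphic_transform[of "\<lambda>_. 1"]) (simp_all add: f0_def)
  moreover have "f1 holomorphic_on unit_disk"
    by (rule holomorphic_transform[of "\<lambda>z. z"]) (simp_all add: f1_def)
  ultimately have h: "f0 \<in> hol_disk" "f1 \<in> hol_disk" by (auto simp: hol_disk_def f0_def f1_def)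
  have "f0 \<in> bergman p \<alpha>"
    by (rule bounded_imp_bergman[OF p \<alpha> h(1)]) (simp add: f0_def)
  moreover have "f1 \<in> bergman p \<alpha>"
    by (rule bounded_imp_bergman[OF p \<alpha> h(2)]) (simp add: f1_def)
  ultimately have b: "weighted_comp u \<phi> f0 \<in> bloch" "weighted_comp u \<phi> f1 \<in> bloch" using TB by blast+
  have d: "deriv f0 w = 0" "deriv f1 w = 1" if "w \<in> unit_disk" for w
  proof -
    have "(f0 has_field_derivative 0) (at w)"
      by (rule has_field_derivative_transform_within_open[of "\<lambda>_. 1", OF _ open_ball that]) (auto simp: f0_def)
    moreover have "(f1 has_field_derivative 1) (at w)"
      by (rule has_field_derivative_transform_within_open[of "\<lambda>z. z", OF _ open_ball that]) (auto simp: f1_def)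
    ultimately show "deriv f0 w = 0" "deriv f1 w = 1" by (auto intro: DERIV_imp_deriv)
  qed
  define M0 where "M0 = bloch_norm (weighted_comp u \<phi> f0)"
  define M1 where "M1 = bloch_norm (weighted_comp u \<phi> f1)"
  have nn: "0 \<le> M0" "0 \<le> M1" by (auto simp: M0_def M1_def bloch_norm_def)
  have le: "(1 - (cmod z)\<^sup>2) * cmod (deriv u z) \<le> M0" "(1 - (cmod z)\<^sup>2) * cmod (u z * deriv \<phi> z) \<le> M1 + M0"
    if z: "z \<in> unit_disk" for z
  proof -
    have w: "\<phi> z \<in> unit_disk" using \<phi>(2) z by blast
    have "deriv (weighted_comp u \<phi> f0) z = deriv u z"
      using DERIV_imp_deriv[OF weighted_comp_has_field_derivative[OF u \<phi> h(1) z]] w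
      by (simp add: d[OF w]) (simp add: f0_def)
    then show le0: "(1 - (cmod z)\<^sup>2) * cmod (deriv u z) \<le> M0"
      using bloch_norm_ge(2)[OF b(1) z] by (simp add: M0_def)
    have "deriv (weighted_comp u \<phi> f1) z = deriv u z * \<phi> z + u z * deriv \<phi> z"
      using DERIV_imp_deriv[OF weighted_comp_has_field_derivative[OF u \<phi> h(2) z]] w
      by (simp add: d[OF w]) (simp add: f1_def)
    then have le1: "(1 - (cmod z)\<^sup>2) * cmod (deriv u z * \<phi> z + u z * deriv \<phi> z) \<le> M1"
      using bloch_norm_ge(2)[OF b(2) z] by (simp add: M1_def)
    have "cmod (u z * deriv \<phi> z) \<le> cmod (deriv u z * \<phi> z + u z * deriv \<phi> z) + cmod (deriv u z * \<phi> z)"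
      using norm_triangle_ineq4[of "deriv u z * \<phi> z + u z * deriv \<phi> z" "deriv u z * \<phi> z"] by simp
    also have "cmod (deriv u z * \<phi> z) \<le> cmod (deriv u z)"
      using w by (simp add: norm_mult mult_left_le)
    finally have "(1 - (cmod z)\<^sup>2) * cmod (u z * deriv \<phi> z) \<le> (1 - (cmod z)\<^sup>2) * (cmod (deriv u z * \<phi> z + u z * deriv \<phi> z) + cmod (deriv u z))"
      using one_minus_cmod_sq(3)[OF z] by (intro mult_left_mono) auto
    with le0 le1 show "(1 - (cmod z)\<^sup>2) * cmod (u z * deriv \<phi> z) \<le> M1 + M0"
      by (simp add: distrib_left)
  qed
  show thesis
    by (rule that[of "M1 + M0"]) (use le nn in \<open>auto intro: order_trans[OF le(1)]\<close>)
qed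

theorem theorem3p3:
  fixes p \<alpha> :: real and u \<phi> :: "complex \<Rightarrow> complex"
  assumes "1 \<le> p" and "-1 < \<alpha>"
    and "u holomorphic_on unit_disk"
    and "\<phi> holomorphic_on unit_disk" and "\<phi> ` unit_disk \<subseteq> unit_disk"
    and "bounded_bergman_bloch p \<alpha> (weighted_comp u \<phi>)"
  shows "compact_bergman_bloch p \<alpha> (weighted_comp u \<phi>) \<longleftrightarrow>
    limsup (\<lambda>j. ennreal (real j powr ((2 + \<alpha>) / p)) * bloch_enorm (I_op u (\<lambda>z. \<phi> z ^ j))) = 0 \<and>
    limsup (\<lambda>j. ennreal (real j powr ((2 + \<alpha>) / p)) * bloch_enorm (J_op u (\<lambda>z. \<phi> z ^ (j - 1)))) = 0"
proof -
  define s where "s = (2 + \<alpha>) / p"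
  have s: "0 < s" using assms(1,2) by (simp add: s_def)
  have TB: "weighted_comp u \<phi> ` bergman p \<alpha> \<subseteq> bloch"
    using assms(6) by (simp add: bounded_bergman_bloch_def)
  obtain M where M: "\<And>z. z \<in> unit_disk \<Longrightarrow> (1 - (cmod z)\<^sup>2) * cmod (deriv u z) \<le> M"
      "\<And>z. z \<in> unit_disk \<Longrightarrow> (1 - (cmod z)\<^sup>2) * cmod (u z * deriv \<phi> z) \<le> M"
    using bounded_weights[OF assms(1-5) TB] by metis
  have \<phi>D: "cmod (\<phi> z) < 1" if "z \<in> unit_disk" for z
    using assms(5) that by (simp add: image_subset_iff)
  have nn: "0 \<le> (1 - (cmod z)\<^sup>2) * cmod c" if "z \<in> unit_disk" for z c
    using one_minus_cmod_sq(3)[OF that] by simp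
  let ?c1 = "\<forall>\<epsilon>>0. \<exists>\<rho><1. \<forall>z\<in>unit_disk. \<rho> < cmod (\<phi> z) \<longrightarrow>
      (1 - (cmod z)\<^sup>2) * cmod (deriv u z) \<le> \<epsilon> * (1 - (cmod (\<phi> z))\<^sup>2) powr s"
  let ?c2 = "\<forall>\<epsilon>>0. \<exists>\<rho><1. \<forall>z\<in>unit_disk. \<rho> < cmod (\<phi> z) \<longrightarrow>
      (1 - (cmod z)\<^sup>2) * cmod (u z * deriv \<phi> z) \<le> \<epsilon> * (1 - (cmod (\<phi> z))\<^sup>2) powr (s + 1)"
  \<comment> \<open>The factor \<open>j\<close> in the Bloch norm is absorbed into the power of
    \<open>j\<close>, which raises the exponent to \<open>s + 1\<close>; for \<open>j = 0\<close>
    both sides are 0.\<close>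
  have "ennreal (real j powr s) * bloch_enorm (I_op u (\<lambda>z. \<phi> z ^ j)) =
    ennreal (real j powr (s + 1)) *
      (SUP z\<in>unit_disk. ennreal ((1 - (cmod z)\<^sup>2) * cmod (u z * deriv \<phi> z) * cmod (\<phi> z) ^ (j - 1)))" for j
    unfolding bloch_enorm_I_op[OF assms(3,4)] mult.assoc[symmetric]
    by (cases "j = 0") (simp_all add: powr_add ennreal_mult)
  then have I: "limsup (\<lambda>j. ennreal (real j powr s) * bloch_enorm (I_op u (\<lambda>z. \<phi> z ^ j))) = 0 \<longleftrightarrow> ?c2"
    using limsup_power_weight_iff[of unit_disk "\<lambda>z. (1 - (cmod z)\<^sup>2) * cmod (u z * deriv \<phi> z)" M "\<lambda>z. cmod (\<phi> z)" "s + 1"]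
      nn M(2) \<phi>D s by simp
  have J: "limsup (\<lambda>j. ennreal (real j powr s) * bloch_enorm (J_op u (\<lambda>z. \<phi> z ^ (j - 1)))) = 0 \<longleftrightarrow> ?c1"
    unfolding bloch_enorm_J_op[OF assms(3,4)]
    by (rule limsup_power_weight_iff[OF nn M(1) norm_ge_zero \<phi>D s])
  have "compact_bergman_bloch p \<alpha> (weighted_comp u \<phi>) \<longleftrightarrow> ?c2 \<and> ?c1"
  proof (intro iffI)
    assume "compact_bergman_bloch p \<alpha> (weighted_comp u \<phi>)"
    from compact_imp_vanishing[OF assms(1-5) this s_def] show "?c2 \<and> ?c1" by (intro conjI allI impI)
  next
    assume "?c2 \<and> ?c1"
    then show "compact_bergman_bloch p \<alpha> (weighted_comp u \<phi>)"
      by (intro vanishing_imp_compact[OF assms(1-5) TB s_def M]) auto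
  qed
  then show ?thesis
    unfolding s_def[symmetric] I J .
qed


end
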